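(* Let $A$ be a $C^*$-algebra, $X$ a Hilbert $A$-module, $\mathcal{H},\mathcal{K}$ Hilbert spaces, $\varphi:A\to L(\mathcal{H})$ a completely positive linear map and $\Phi:X\to L(\mathcal{H},\mathcal{K})$ a $\varphi$-map. Then: (1) $XT_\varphi=X_\varphi$, where $XT_\varphi=\{xa:x\in X,\ a\in T_\varphi\}$; (2) $\Phi(xa)=\Phi(x)\varphi(a)$ for every $a\in M_\varphi$ and $x\in X$; (3) $\Phi(xab)=\Phi(x)\varphi(a)\varphi(b)$ for every $a\in T_\varphi$, $x\in X$ and $b\in A$.
   Context: Hilbert $C^*$-modules are right modules, with inner product linear in the second variable. $L(\mathcal{H},\mathcal{K})$ denotes the bounded linear operators from $\mathcal{H}$ to $\mathcal{K}$, and $L(\mathcal{H})=L(\mathcal{H},\mathcal{H})$. A map $\Phi:X\to L(\mathcal{H},\mathcal{K})$ is a $\varphi$-map if $\Phi(x)^*\Phi(y)=\varphi(\langle x,y\rangle)$ for all $x,y\in X$. Definitions: $M_\varphi=\{a\in A:\varphi(ab)=\varphi(a)\varphi(b)\text{ and }\varphi(ba)=\varphi(b)\varphi(a)\text{ for all }b\in A\}$; $T_\varphi=\{a\in M_\varphi:\varphi(ba^*c)=\varphi(b)\varphi(a)^*\varphi(c)\text{ for all }b,c\in A\}$. The ternary domain $X_\varphi$ of $\varphi$ on $X$ is the set $\{x\in X:\Phi(xb)=\Phi(x)\varphi(b)\text{ for all }b\in A\}$, where $\Phi$ is any operator-valued $\varphi$-map on $X$; such maps exist and the set is the same for every choice of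 $\Phi$ (equivalently $X_\varphi=\{x\in X:\langle x,x\rangle\in T_\varphi\}$). *)

theory Defs
  imports "HOL-Analysis.Analysis"
begin

section \<open>Complex Banach spaces, Hilbert spaces and C*-algebras\<close>

class complex_vector = real_vector +
  fixes scaleC :: "complex \<Rightarrow> 'a \<Rightarrow> 'a" (infixr "*\<^sub>C" 75)
  assumes scaleC_add_right: "c *\<^sub>C (x + y) = c *\<^sub>C x + c *\<^sub>C y"
    and scaleC_add_left: "(c + d) *\<^sub>C x = c *\<^sub>C x + d *\<^sub>C x"
    and scaleC_scaleC: "c *\<^sub>C (d *\<^sub>C x) = (c * d) *\<^sub>C x"
    and scaleC_of_real: "complex_of_real r *\<^sub>C x = r *\<^sub>R x"

class complex_banach = complex_vector + banach +
  assumes norm_scaleC: "norm (c *\<^sub>C x) = cmod c * norm x"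

text \<open>The algebra need not be unital and may be zero. Submultiplicativity of the norm is part of
  \<^class>\<open>real_normed_algebra\<close>.\<close>

class cstar_algebra = complex_banach + real_normed_algebra +
  fixes star :: "'a \<Rightarrow> 'a"
  assumes scaleC_mult_left: "(c *\<^sub>C x) * y = c *\<^sub>C (x * y)"
    and scaleC_mult_right: "x * (c *\<^sub>C y) = c *\<^sub>C (x * y)"
    and star_star: "star (star x) = x"
    and star_add: "star (x + y) = star x + star y"
    and star_scaleC: "star (c *\<^sub>C x) = cnj c *\<^sub>C star x"
    and star_mult: "star (x * y) = star y * star x"
    and cstar_norm: "norm (star x * x) = (norm x)\<^sup>2"

class complex_hilbert = complex_banach +
  fixes cinner :: "'a \<Rightarrow> 'a \<Rightarrow> complex"
  assumes cinner_add_right: "cinner x (y + z) = cinner x y + cinner x z"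
    and cinner_scaleC_right: "cinner x (c *\<^sub>C y) = c * cinner x y"
    and cinner_commute: "cinner y x = cnj (cinner x y)"
    and cinner_self: "cinner x x = complex_of_real ((norm x)\<^sup>2)"

definition clinear :: "('a::complex_vector \<Rightarrow> 'b::complex_vector) \<Rightarrow> bool" where
  "clinear f \<longleftrightarrow> (\<forall>x y. f (x + y) = f x + f y) \<and> (\<forall>c x. f (c *\<^sub>C x) = c *\<^sub>C f x)"


section \<open>Bounded operators between Hilbert spaces\<close>

lemma scaleC_zero_right [simp]: "c *\<^sub>C (0 :: 'a::complex_vector) = 0"
  using scaleC_add_right[of c "0::'a" 0] by simp

lemma scaleC_minus_right: "c *\<^sub>C (- x) = - (c *\<^sub>C (x :: 'a::complex_vector))"
  using scaleC_add_right[of c x "- x"] by (simp add: eq_neg_iff_add_eq_0 add.commute)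

lemma bounded_linear_scaleC: "bounded_linear (\<lambda>x :: 'a::complex_banach. c *\<^sub>C x)"
proof (rule bounded_linear_intro[where K = "cmod c"])
  fix r and x :: 'a
  have "c *\<^sub>C (complex_of_real r *\<^sub>C x) = complex_of_real r *\<^sub>C (c *\<^sub>C x)"
    by (simp add: scaleC_scaleC mult.commute)
  thus "c *\<^sub>C (r *\<^sub>R x) = r *\<^sub>R (c *\<^sub>C x)" by (simp only: scaleC_of_real)
qed (simp_all add: scaleC_add_right norm_scaleC mult.commute)

typedef (overloaded) ('h, 'k) bounded_op =
  "{T :: 'h::complex_hilbert \<Rightarrow> 'k::complex_hilbert. bounded_linear T \<and> clinear T}"
  morphisms op_apply Bounded_Op
  by (rule exI[of _ "\<lambda>_. 0"]) (simp add: clinear_def)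

setup_lifting type_definition_bounded_op

lemma op_eqI: "(\<And>x. op_apply S x = op_apply T x) \<Longrightarrow> S = T"
  by (simp add: op_apply_inject[symmetric] fun_eq_iff)

instantiation bounded_op :: (complex_hilbert, complex_hilbert) complex_vector
begin

lift_definition zero_bounded_op :: "('a, 'b) bounded_op" is "\<lambda>_. 0"
  by (simp add: clinear_def)

lift_definition plus_bounded_op :: "('a, 'b) bounded_op \<Rightarrow> ('a, 'b) bounded_op \<Rightarrow> ('a, 'b) bounded_op"
  is "\<lambda>S T x. S x + T x"
  by (auto simp: clinear_def scaleC_add_right intro: bounded_linear_add)

lift_definition uminus_bounded_op :: "('a, 'b) bounded_op \<Rightarrow> ('a, 'b) bounded_op"
  is "\<lambda>T x. - T x"
  by (auto simp: clinear_def scaleC_minus_right intro: bounded_linear_minus)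

definition minus_bounded_op :: "('a, 'b) bounded_op \<Rightarrow> ('a, 'b) bounded_op \<Rightarrow> ('a, 'b) bounded_op"
  where "minus_bounded_op S T = S + - T"

lift_definition scaleC_bounded_op :: "complex \<Rightarrow> ('a, 'b) bounded_op \<Rightarrow> ('a, 'b) bounded_op"
  is "\<lambda>c T x. c *\<^sub>C T x"
  by (auto simp: clinear_def scaleC_add_right scaleC_scaleC mult.commute
      intro: bounded_linear_compose[OF bounded_linear_scaleC])

definition scaleR_bounded_op :: "real \<Rightarrow> ('a, 'b) bounded_op \<Rightarrow> ('a, 'b) bounded_op"
  where "scaleR_bounded_op r T = complex_of_real r *\<^sub>C T"

instance
proof
  fix r s :: real and c d :: complex and S T U :: "('a, 'b) bounded_op"
  show "S + T + U = S + (T + U)" by transfer (simp add: add.assoc)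
  show "S + T = T + S" by transfer (simp add: add.commute)
  show "0 + S = S" by transfer simp
  show "- S + S = 0" by transfer simp
  show "S - T = S + - T" by (rule minus_bounded_op_def)
  show add_right: "c *\<^sub>C (S + T) = c *\<^sub>C S + c *\<^sub>C T" for c and S T :: "('a, 'b) bounded_op"
    by transfer (simp add: scaleC_add_right)
  show add_left: "(c + d) *\<^sub>C S = c *\<^sub>C S + d *\<^sub>C S" for c d and S :: "('a, 'b) bounded_op"
    by transfer (simp add: scaleC_add_left)
  show assoc: "c *\<^sub>C d *\<^sub>C S = (c * d) *\<^sub>C S" for c d and S :: "('a, 'b) bounded_op"
    by transfer (simp add: scaleC_scaleC)
  show "complex_of_real r *\<^sub>C S = r *\<^sub>R S" by (simp add: scaleR_bounded_op_def)
  show "r *\<^sub>R (S + T) = r *\<^sub>R S + r *\<^sub>R T" by (simp add: scaleR_bounded_op_def add_right)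
  show "(r + s) *\<^sub>R S = r *\<^sub>R S + s *\<^sub>R S" by (simp add: scaleR_bounded_op_def add_left)
  show "r *\<^sub>R s *\<^sub>R S = (r * s) *\<^sub>R S" by (simp add: scaleR_bounded_op_def assoc)
  have "complex_of_real 1 *\<^sub>C S = S" by transfer (simp only: scaleC_of_real scaleR_one)
  thus "1 *\<^sub>R S = S" by (simp add: scaleR_bounded_op_def)
qed

end

lift_definition op_comp ::
  "('k::complex_hilbert, 'l::complex_hilbert) bounded_op \<Rightarrow> ('h::complex_hilbert, 'k) bounded_op
    \<Rightarrow> ('h, 'l) bounded_op" (infixl "\<circ>\<^sub>L" 70)
  is "\<lambda>S T x. S (T x)"
  by (auto simp: clinear_def intro: bounded_linear_compose)

definition op_adj ::
  "('h::complex_hilbert, 'k::complex_hilbert) bounded_op \<Rightarrow> ('k, 'h) bounded_op" where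
  "op_adj T = (THE S. \<forall>x y. cinner (op_apply S y) x = cinner y (op_apply T x))"

text \<open>The description in \<^const>\<open>op_adj\<close> is proper: the adjoint exists and is unique.\<close>

lemma cinner_add_left: "cinner (x + y) z = cinner x z + cinner y (z :: 'a::complex_hilbert)"
  by (metis cinner_add_right cinner_commute complex_cnj_add)

lemma cinner_scaleC_left: "cinner (c *\<^sub>C x) y = cnj c * cinner x (y :: 'a::complex_hilbert)"
  by (metis cinner_commute cinner_scaleC_right complex_cnj_mult)

lemma cinner_minus_right: "cinner x (- y) = - cinner x (y :: 'a::complex_hilbert)"
  using cinner_add_right[of x y "- y"] cinner_add_right[of x 0 0]
  by (simp add: eq_neg_iff_add_eq_0 add.commute)

lemma cinner_minus_left: "cinner (- x) y = - cinner x (y :: 'a::complex_hilbert)"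
  by (metis cinner_commute cinner_minus_right complex_cnj_minus)

lemma norm_add_sq: "(norm (x + y))\<^sup>2 = (norm x)\<^sup>2 + 2 * Re (cinner x y) + (norm (y :: 'a::complex_hilbert))\<^sup>2"
proof -
  have "complex_of_real ((norm (x + y))\<^sup>2)
      = complex_of_real ((norm x)\<^sup>2) + cinner x y + cnj (cinner x y) + complex_of_real ((norm y)\<^sup>2)"
    unfolding cinner_self[symmetric]
    by (simp add: cinner_add_left cinner_add_right cinner_commute[of y x])
  from arg_cong[OF this, of Re] show ?thesis by simp
qed

lemma cinner_ext:
  assumes "\<And>x :: 'a::complex_hilbert. cinner u x = cinner v x"
  shows "u = v"
proof -
  have "cinner (u + - v) (u + - v) = 0"
    by (simp only: cinner_add_left cinner_minus_left assms) simp
  thus ?thesis by (simp add: cinner_self)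
qed

lemma quadratic_bound:
  fixes a b :: real
  assumes "\<And>t. 0 \<le> t * a + t\<^sup>2 * b"
  shows "a = 0"
proof (rule ccontr)
  assume "a \<noteq> 0"
  define k where "k = 1 + \<bar>b\<bar>"
  have k: "k > 0" "b < k" unfolding k_def by linarith+
  have "(- a / k) * a + (- a / k)\<^sup>2 * b = (a\<^sup>2 / k\<^sup>2) * (b - k)"
    using k by (simp add: field_simps power2_eq_square)
  moreover have "(a\<^sup>2 / k\<^sup>2) * (b - k) < 0"
    using k \<open>a \<noteq> 0\<close> by (intro mult_pos_neg) auto
  ultimately show False using assms[of "- a / k"] by simp
qed

lemma riesz:
  fixes f :: "'a::complex_hilbert \<Rightarrow> complex"
  assumes bl: "bounded_linear f" and sc: "\<And>c x. f (c *\<^sub>C x) = c * f x"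
  shows "\<exists>v. \<forall>x. f x = cinner v x"
proof -
  interpret f: bounded_linear f by fact
  define q where "q x = (norm x)\<^sup>2 - 2 * Re (f x)" for x
  obtain K where K: "\<And>x. norm (f x) \<le> norm x * K" "K \<ge> 0" using f.nonneg_bounded by blast
  have lower: "- K\<^sup>2 \<le> q x" for x
  proof -
    have "Re (f x) \<le> norm x * K" using K(1)[of x] complex_Re_le_cmod[of "f x"] by linarith
    moreover have "0 \<le> (norm x - K)\<^sup>2" by simp
    ultimately show ?thesis unfolding q_def by (simp add: power2_diff algebra_simps)
  qed
  define m where "m = (INF x. q x)"
  have bdd: "bdd_below (range q)" using lower by (auto intro!: bdd_belowI)
  have m: "m \<le> q x" for x unfolding m_def by (rule cINF_lower[OF bdd]) simp
  have "\<exists>x. q x < m + 1 / real (Suc n)" for n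
    using cINF_less_iff[of UNIV q "m + 1 / real (Suc n)"] bdd by (simp add: m_def)
  then obtain s where s: "\<And>n. q (s n) < m + 1 / real (Suc n)" by metis
  have para: "(norm (x - y))\<^sup>2 \<le> 2 * (q x - m) + 2 * (q y - m)" for x y
  proof -
    have d: "(norm (x - y))\<^sup>2 = (norm x)\<^sup>2 - 2 * Re (cinner x y) + (norm y)\<^sup>2"
      using norm_add_sq[of x "- y"] by (simp add: cinner_minus_right)
    have "m \<le> q ((1/2) *\<^sub>R (x + y))" by (rule m)
    also have "\<dots> = (norm (x + y))\<^sup>2 / 4 - Re (f x) - Re (f y)"
    proof -
      have "(norm ((1/2) *\<^sub>R (x + y)))\<^sup>2 = (norm (x + y))\<^sup>2 / 4"
        by (simp only: norm_scaleR) (simp add: power2_eq_square)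
      moreover have "f ((1/2) *\<^sub>R (x + y)) = (1/2) *\<^sub>R (f x + f y)"
        by (simp only: f.scaleR f.add)
      ultimately show ?thesis unfolding q_def by (simp only: scaleR_complex.sel plus_complex.sel) argo
    qed
    finally show ?thesis
      unfolding d unfolding norm_add_sq q_def by (simp add: field_simps)
  qed
  have "Cauchy s"
  proof (rule metric_CauchyI)
    fix e :: real assume e: "0 < e"
    obtain N where "4 / e\<^sup>2 < real N" using reals_Archimedean2 by blast
    hence N: "4 / e\<^sup>2 < real (Suc N)" by simp
    show "\<exists>M. \<forall>i\<ge>M. \<forall>j\<ge>M. dist (s i) (s j) < e"
    proof (intro exI allI impI)
      fix i j assume ij: "i \<ge> N" "j \<ge> N"
      have b: "q (s k) - m < 1 / real (Suc N)" if "k \<ge> N" for k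
      proof -
        have "1 / real (Suc k) \<le> 1 / real (Suc N)" using that by (simp add: frac_le)
        thus ?thesis using s[of k] by linarith
      qed
      have "(norm (s i - s j))\<^sup>2 < 4 / real (Suc N)"
        using para[of "s i" "s j"] b[OF ij(1)] b[OF ij(2)] by simp
      also have "\<dots> < e\<^sup>2" using N e by (simp add: field_simps)
      finally show "dist (s i) (s j) < e"
        unfolding dist_norm using e by (simp add: power_less_imp_less_base)
    qed
  qed
  then obtain v where v: "s \<longlonglongrightarrow> v" using Cauchy_convergent convergent_def by blast
  have "(\<lambda>n. q (s n)) \<longlonglongrightarrow> q v" unfolding q_def
    by (intro tendsto_intros f.tendsto v)
  moreover have "(\<lambda>n. m + 1 / real (Suc n)) \<longlonglongrightarrow> m + 0"
    by (intro tendsto_add tendsto_const) (rule LIMSEQ_Suc[OF lim_1_over_n])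
  ultimately have "q v \<le> m + 0"
    by (rule LIMSEQ_le) (use s less_imp_le in blast)
  hence qv: "q v \<le> q x" for x using m[of x] by linarith
  have Re_eq: "Re (f x) = Re (cinner v x)" for x
  proof -
    have "0 \<le> t * (2 * Re (cinner v x) - 2 * Re (f x)) + t\<^sup>2 * (norm x)\<^sup>2" for t
    proof -
      have "cinner v (t *\<^sub>R x) = complex_of_real t * cinner v x"
        by (simp only: scaleC_of_real[symmetric] cinner_scaleC_right)
      hence "q (v + t *\<^sub>R x) = q v + t * (2 * Re (cinner v x) - 2 * Re (f x)) + t\<^sup>2 * (norm x)\<^sup>2"
        unfolding q_def norm_add_sq by (simp add: f.add f.scaleR power_mult_distrib algebra_simps)
      thus ?thesis using qv[of "v + t *\<^sub>R x"] by linarith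
    qed
    from quadratic_bound[OF this] show ?thesis by simp
  qed
  have "f x = cinner v x" for x
    using Re_eq[of x] Re_eq[of "\<i> *\<^sub>C x"] by (simp add: sc cinner_scaleC_right complex_eq_iff)
  thus ?thesis by blast
qed

lemma cinner_bound: "cmod (cinner u x) \<le> norm u * norm (x :: 'a::complex_hilbert)"
proof -
  have re: "Re (cinner u z) \<le> norm u * norm z" for z :: 'a
  proof -
    have "(norm (u + z))\<^sup>2 \<le> (norm u + norm z)\<^sup>2"
      by (intro power_mono norm_triangle_ineq) simp
    thus ?thesis unfolding norm_add_sq by (simp add: power2_sum)
  qed
  have "cnj (sgn (cinner u x)) * cinner u x = complex_of_real (cmod (cinner u x))"
    by (cases "cinner u x = 0")
      (simp_all add: sgn_eq complex_norm_square[symmetric] mult.commute[of "cnj _"] power2_eq_square)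
  hence "cmod (cinner u x) = Re (cinner u (cnj (sgn (cinner u x)) *\<^sub>C x))"
    by (simp add: cinner_scaleC_right)
  also have "\<dots> \<le> norm u * (cmod (sgn (cinner u x)) * norm x)"
    using re[of "cnj (sgn (cinner u x)) *\<^sub>C x"] by (simp add: norm_scaleC)
  also have "\<dots> \<le> norm u * norm x"
    by (intro mult_left_mono) (auto simp: norm_sgn)
  finally show ?thesis .
qed

lemma op_adj_exists:
  fixes T :: "('h::complex_hilbert, 'k::complex_hilbert) bounded_op"
  shows "\<exists>S. \<forall>x y. cinner (op_apply S y) x = cinner y (op_apply T x)"
proof -
  have T: "bounded_linear (op_apply T)" "clinear (op_apply T)" using op_apply[of T] by auto
  interpret T: bounded_linear "op_apply T" by (rule T)
  obtain K where K: "\<And>x. norm (op_apply T x) \<le> norm x * K" "K \<ge> 0"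
    using T.nonneg_bounded by blast
  have bound: "cmod (cinner y (op_apply T x)) \<le> norm x * (norm y * K)" for x y
  proof -
    have "cmod (cinner y (op_apply T x)) \<le> norm y * norm (op_apply T x)" by (rule cinner_bound)
    also have "\<dots> \<le> norm y * (norm x * K)" by (intro mult_left_mono K) simp
    finally show ?thesis by (simp add: mult_ac)
  qed
  have "\<exists>v. \<forall>x. cinner y (op_apply T x) = cinner v x" for y
  proof (rule riesz)
    show "bounded_linear (\<lambda>x. cinner y (op_apply T x))"
    proof (rule bounded_linear_intro)
      show "cinner y (op_apply T (r *\<^sub>R x)) = r *\<^sub>R cinner y (op_apply T x)" for r x
        unfolding T.scaleR by (simp only: scaleC_of_real[symmetric] cinner_scaleC_right scaleR_conv_of_real)
    qed (rule bound | simp add: T.add cinner_add_right)+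
    show "cinner y (op_apply T (c *\<^sub>C x)) = c * cinner y (op_apply T x)" for c x
      using T(2) by (simp add: clinear_def cinner_scaleC_right)
  qed
  then obtain S where S: "\<And>x y. cinner y (op_apply T x) = cinner (S y) x" by metis
  have cl: "S (y + z) = S y + S z" "S (c *\<^sub>C y) = c *\<^sub>C S y" for y z c
    by (rule cinner_ext; simp add: cinner_add_left cinner_scaleC_left S[symmetric])+
  have "bounded_linear S"
  proof (rule bounded_linear_intro)
    show "S (r *\<^sub>R y) = r *\<^sub>R S y" for r y by (simp only: scaleC_of_real[symmetric] cl)
    show "norm (S y) \<le> norm y * K" for y
    proof (cases "S y = 0")
      case False
      have "(norm (S y))\<^sup>2 = cmod (cinner (S y) (S y))"
        by (simp add: cinner_self norm_power)
      also have "\<dots> \<le> norm (S y) * (norm y * K)" by (simp add: S[symmetric] bound)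
      finally show ?thesis using False by (simp add: power2_eq_square)
    qed (use K(2) in simp)
  qed (rule cl)
  hence "op_apply (Bounded_Op S) = S" by (intro Bounded_Op_inverse) (simp add: clinear_def cl)
  thus ?thesis using S by metis
qed

lemma op_adj_unique:
  assumes "\<And>x y. cinner (op_apply S y) x = cinner y (op_apply T x)"
  shows "op_adj T = S"
  unfolding op_adj_def
proof (rule the_equality)
  fix S' assume S': "\<forall>x y. cinner (op_apply S' y) x = cinner y (op_apply T x)"
  show "S' = S"
    by (rule op_eqI, rule cinner_ext) (simp add: S' assms)
qed (simp add: assms)

lemma cinner_op_adj: "cinner (op_apply (op_adj T) y) x = cinner y (op_apply T x)"
proof -
  obtain S where S: "\<forall>x y. cinner (op_apply S y) x = cinner y (op_apply T x)"
    using op_adj_exists by blast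
  thus ?thesis by (subst op_adj_unique[of S]) simp_all
qed


section \<open>Complete positivity\<close>

text \<open>An \<open>n \<times> n\<close> matrix is a function of two indices of which only the values at indices
  below \<open>n\<close> matter. Positivity in the C*-algebra \<open>M\<^sub>n(A)\<close> means being of the form \<open>C\<^sup>* C\<close>;
  positivity in \<open>M\<^sub>n(L(H)) = L(H\<^sup>n)\<close> is positivity of the operator on \<open>H\<^sup>n\<close>.\<close>

definition positive_elem :: "'a::cstar_algebra \<Rightarrow> bool" where
  "positive_elem a \<longleftrightarrow> (\<exists>c. a = star c * c)"

definition positive_matrix :: "nat \<Rightarrow> (nat \<Rightarrow> nat \<Rightarrow> 'a::cstar_algebra) \<Rightarrow> bool" where
  "positive_matrix n a \<longleftrightarrow>
    (\<exists>c :: nat \<Rightarrow> nat \<Rightarrow> 'a. \<forall>i<n. \<forall>j<n. a i j = (\<Sum>k<n. star (c k i) * c k j))"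

definition positive_op_matrix ::
  "nat \<Rightarrow> (nat \<Rightarrow> nat \<Rightarrow> ('h::complex_hilbert, 'h) bounded_op) \<Rightarrow> bool" where
  "positive_op_matrix n T \<longleftrightarrow>
    (\<forall>h :: nat \<Rightarrow> 'h. (\<Sum>i<n. cinner (h i) (\<Sum>j<n. op_apply (T i j) (h j))) \<in> \<real>\<^sub>\<ge>\<^sub>0)"

definition completely_positive ::
  "('a::cstar_algebra \<Rightarrow> ('h::complex_hilbert, 'h) bounded_op) \<Rightarrow> bool" where
  "completely_positive \<phi> \<longleftrightarrow>
    (\<forall>n a. positive_matrix n a \<longrightarrow> positive_op_matrix n (\<lambda>i j. \<phi> (a i j)))"


section \<open>Hilbert modules and \<open>\<phi>\<close>-maps\<close>

text \<open>Completeness of the module is completeness of the type \<open>'x\<close>, whose norm is required to be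
  the one induced by the \<open>A\<close>-valued inner product.\<close>

locale hilbert_module =
  fixes act :: "'x::complex_banach \<Rightarrow> 'a::cstar_algebra \<Rightarrow> 'x" (infixl "\<cdot>" 75)
    and ip :: "'x \<Rightarrow> 'x \<Rightarrow> 'a" ("\<langle>_, _\<rangle>")
  assumes act_add_left: "(x + y) \<cdot> a = x \<cdot> a + y \<cdot> a"
    and act_add_right: "x \<cdot> (a + b) = x \<cdot> a + x \<cdot> b"
    and act_mult: "x \<cdot> (a * b) = (x \<cdot> a) \<cdot> b"
    and act_scaleC_left: "(c *\<^sub>C x) \<cdot> a = c *\<^sub>C (x \<cdot> a)"
    and act_scaleC_right: "x \<cdot> (c *\<^sub>C a) = c *\<^sub>C (x \<cdot> a)"
    and ip_add_right: "\<langle>x, y + z\<rangle> = \<langle>x, y\<rangle> + \<langle>x, z\<rangle>"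
    and ip_scaleC_right: "\<langle>x, c *\<^sub>C y\<rangle> = c *\<^sub>C \<langle>x, y\<rangle>"
    and ip_act_right: "\<langle>x, y \<cdot> a\<rangle> = \<langle>x, y\<rangle> * a"
    and ip_commute: "\<langle>y, x\<rangle> = star \<langle>x, y\<rangle>"
    and ip_positive: "positive_elem \<langle>x, x\<rangle>"
    and ip_definite: "\<langle>x, x\<rangle> = 0 \<Longrightarrow> x = 0"
    and norm_ip: "norm x = sqrt (norm \<langle>x, x\<rangle>)"

definition phi_map ::
  "('x \<Rightarrow> 'x \<Rightarrow> 'a) \<Rightarrow> ('a \<Rightarrow> ('h::complex_hilbert, 'h) bounded_op)
    \<Rightarrow> ('x \<Rightarrow> ('h, 'k::complex_hilbert) bounded_op) \<Rightarrow> bool" where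
  "phi_map ip \<phi> \<Phi> \<longleftrightarrow> (\<forall>x y. op_adj (\<Phi> x) \<circ>\<^sub>L \<Phi> y = \<phi> (ip x y))"

definition multiplicative_domain ::
  "('a::cstar_algebra \<Rightarrow> ('h::complex_hilbert, 'h) bounded_op) \<Rightarrow> 'a set" where
  "multiplicative_domain \<phi> =
    {a. \<forall>b. \<phi> (a * b) = \<phi> a \<circ>\<^sub>L \<phi> b \<and> \<phi> (b * a) = \<phi> b \<circ>\<^sub>L \<phi> a}"

definition ternary_domain_alg ::
  "('a::cstar_algebra \<Rightarrow> ('h::complex_hilbert, 'h) bounded_op) \<Rightarrow> 'a set" where
  "ternary_domain_alg \<phi> =
    {a \<in> multiplicative_domain \<phi>.
      \<forall>b c. \<phi> (b * star a * c) = \<phi> b \<circ>\<^sub>L op_adj (\<phi> a) \<circ>\<^sub>L \<phi> c}"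

text \<open>The set does not depend on the choice of the \<open>\<phi>\<close>-map \<open>\<Phi>\<close>, which is therefore a parameter.\<close>

definition ternary_domain ::
  "('x \<Rightarrow> 'a \<Rightarrow> 'x) \<Rightarrow> ('a \<Rightarrow> ('h::complex_hilbert, 'h) bounded_op)
    \<Rightarrow> ('x \<Rightarrow> ('h, 'k::complex_hilbert) bounded_op) \<Rightarrow> 'x set" where
  "ternary_domain act \<phi> \<Phi> = {x. \<forall>b. \<Phi> (act x b) = \<Phi> x \<circ>\<^sub>L \<phi> b}"

end

theory Submission
  imports Defs
begin

text \<open>
  All operator identities about \<open>\<Phi>\<close> come from one observation, \<open>phi_map_eqI\<close>: the Gram operators
  \<open>\<Phi>(u)\<^sup>* \<Phi>(v) = \<phi>(\<langle>u, v\<rangle>)\<close> determine \<open>\<Phi>\<close> so tightly that \<open>\<Phi>(y) = \<Phi>(x) S\<close> follows from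
  \<open>\<phi>(\<langle>y, y\<rangle>) = \<phi>(\<langle>y, x\<rangle>) S\<close> and \<open>\<phi>(\<langle>x, y\<rangle>) = \<phi>(\<langle>x, x\<rangle>) S\<close>, because these two equations make the
  range of \<open>\<Phi>(y) - \<Phi>(x) S\<close> orthogonal to itself. For \<open>y = xa\<close> and \<open>S = \<phi>(a)\<close> both equations are
  instances of \<open>\<phi>(ua) = \<phi>(u) \<phi>(a)\<close>. For \<open>y = xab\<close>, with \<open>xa\<close> in the role of \<open>x\<close>
  and \<open>S = \<phi>(b)\<close>, they are instances of \<open>\<phi>(uab) = \<phi>(ua) \<phi>(b)\<close>. This gives (2), (3) and the
  inclusion of \<open>X T\<^sub>\<phi>\<close> in \<open>X\<^sub>\<phi>\<close>.

  The other inclusion is a factorization theorem. Let \<open>x \<in> X\<^sub>\<phi>\<close> and \<open>c = \<langle>x, x\<rangle>\<close>; a direct computation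
  shows \<open>c \<in> T\<^sub>\<phi>\<close> (\<open>ternary_domain_ip\<close>). After rescaling, \<open>c\<close> is a contraction, and \<open>a = (c\<^sup>2)^(1/8)\<close>
  is so much larger than \<open>\<bar>x\<bar> = c^(1/2)\<close> that \<open>x = y a\<close> for some \<open>y\<close>, namely the limit of
  \<open>x (a + \<epsilon>)\<^sup>-\<^sup>1\<close> (\<open>factorization\<close>). It remains to see that the root \<open>a\<close> is again in \<open>T\<^sub>\<phi>\<close>, which
  is a passage to a limit of polynomials in \<open>c\<close>. The continuity behind it is this: for fixed \<open>l\<close> and \<open>r\<close> in \<open>A\<close> the map
  \<open>q \<mapsto> \<phi>(l q r)\<close> is weakly continuous on the unitization of \<open>A\<close>, as \<open>r\<^sup>* q\<^sup>* q r \<le> \<parallel>q\<parallel>\<^sup>2 r\<^sup>* r\<close> and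
  \<open>\<phi>\<close> is 2-positive. Writing \<open>f = a^(1/4)\<close>, the element \<open>a = f f\<^sup>2 f\<close> is the limit of
  elements \<open>f q\<^sub>n f\<close> with \<open>q\<^sub>n \<rightarrow> f\<^sup>2\<close> chosen so that \<open>f q\<^sub>n f = c s\<^sub>n c\<close>, where \<open>s\<^sub>n\<close> is a
  limit of polynomials in \<open>c\<close>; a second passage to the limit puts \<open>c s\<^sub>n c\<close> in \<open>T\<^sub>\<phi>\<close>
  (\<open>ternary_subalgebra_root\<close>).

  The same factorization, for \<open>A\<close> as a module over itself, shows that every element of \<open>A\<close> is a
  product, and therefore that \<open>\<phi>\<close> preserves adjoints (\<open>completely_positive_star\<close>).

  The roots come from power series. The binomial series of \<open>\<surd>(1 - z)\<close> converges absolutely on the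
  closed unit ball of any unital Banach algebra, and for a self-adjoint contraction \<open>c\<close> the element
  \<open>c + \<i> \<surd>(1 - c\<^sup>2)\<close> is unitary, which yields \<open>\<parallel>1 - c\<^sup>2\<parallel> \<le> 1\<close>; so square roots of \<open>c\<^sup>2\<close> can be taken
  again and again.
\<close>

section \<open>Square roots by power series\<close>

text \<open>The coefficients of the binomial series \<open>\<surd>(1 - z) = (\<Sum>n. sqrt_coeff n * z ^ n)\<close>.\<close>

definition sqrt_coeff :: "nat \<Rightarrow> real" where
  "sqrt_coeff n = pochhammer (- 1 / 2) n / fact n"

lemma sqrt_coeff_Suc_nonpos: "sqrt_coeff (Suc n) \<le> 0"
proof -
  have "pochhammer (1 / 2 :: real) n > 0" by (rule pochhammer_pos) simp
  thus ?thesis unfolding sqrt_coeff_def pochhammer_rec by (simp add: divide_nonpos_pos)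
qed

lemma sum_sqrt_coeff: "(\<Sum>k\<le>n. sqrt_coeff k) = pochhammer (1 / 2) n / fact n"
proof (induction n)
  case (Suc n)
  have 1: "sqrt_coeff (Suc n) = - 1 / 2 * pochhammer (1 / 2) n / fact (Suc n)"
    unfolding sqrt_coeff_def pochhammer_rec by simp
  have 2: "pochhammer (1 / 2) n / fact n = (real n + 1) * pochhammer (1 / 2 :: real) n / fact (Suc n)"
    using mult_divide_mult_cancel_left[of "real n + 1" "pochhammer (1 / 2) n" "fact n"]
    by (simp add: add.commute)
  have 3: "pochhammer (1 / 2 :: real) (Suc n) = pochhammer (1 / 2) n * (1 / 2 + real n)"
    by (rule pochhammer_Suc)
  show ?case unfolding sum.atMost_Suc Suc 1 2 3 add_divide_distrib[symmetric]
    by (simp add: algebra_simps)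
qed (simp add: sqrt_coeff_def)

text \<open>All coefficients but the first, which is 1, are nonpositive, while the partial sums of the series at
  \<open>z = 1\<close> stay nonnegative. Hence the series converges absolutely on the closed unit ball; it is
  needed up to the boundary because \<open>1 - z\<close> will be an element that is not invertible.\<close>

lemma sum_abs_sqrt_coeff: "(\<Sum>k<n. \<bar>sqrt_coeff (Suc k)\<bar>) \<le> 1"
proof -
  have "0 < pochhammer (1 / 2 :: real) n" by (rule pochhammer_pos) simp
  hence "0 \<le> (\<Sum>k\<le>n. sqrt_coeff k)" by (simp add: sum_sqrt_coeff)
  also have "\<dots> = 1 - (\<Sum>k<n. \<bar>sqrt_coeff (Suc k)\<bar>)"
    by (subst sum.atMost_shift)
      (simp add: sqrt_coeff_Suc_nonpos abs_of_nonpos sum_negf sqrt_coeff_def[of 0])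
  finally show ?thesis by simp
qed

lemma summable_abs_sqrt_coeff: "summable (\<lambda>k. \<bar>sqrt_coeff (Suc k)\<bar>)"
  by (rule summableI_nonneg_bounded[OF _ sum_abs_sqrt_coeff]) simp

text \<open>The square of the series is \<open>1 - z\<close>, by the Vandermonde identity for rising factorials.\<close>

lemma sqrt_coeff_convolution:
  "(\<Sum>k\<le>n. sqrt_coeff k * sqrt_coeff (n - k)) = (if n = 0 then 1 else if n = 1 then - 1 else 0)"
proof -
  have "(\<Sum>k\<le>n. sqrt_coeff k * sqrt_coeff (n - k)) = pochhammer (- 1 / 2 + - 1 / 2) n / fact n"
    unfolding pochhammer_binomial_sum sum_divide_distrib
    by (intro sum.cong) (auto simp: sqrt_coeff_def binomial_fact)
  moreover have "pochhammer (- 1 :: real) n = 0" if "n \<ge> 2"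
    using that pochhammer_of_nat_eq_0_lemma[of 1 n, where 'a = real] by simp
  moreover have "n = 0 \<or> n = 1 \<or> n \<ge> 2" by linarith
  ultimately show ?thesis by (auto simp: pochhammer_Suc0)
qed

definition sqrt_one_minus :: "'b::{banach,real_normed_algebra_1} \<Rightarrow> 'b" where
  "sqrt_one_minus z = (\<Sum>n. sqrt_coeff n *\<^sub>R z ^ n)"

lemma norm_sqrt_term:
  fixes z :: "'b::{banach,real_normed_algebra_1}"
  assumes "norm z \<le> 1"
  shows "norm (sqrt_coeff n *\<^sub>R z ^ n) \<le> \<bar>sqrt_coeff n\<bar>"
proof -
  have "norm (z ^ n) \<le> 1" using norm_power_ineq[of z n] power_le_one[OF norm_ge_zero assms] by (rule order_trans)
  thus ?thesis by (simp add: mult_left_le)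
qed

lemma summable_norm_sqrt_one_minus:
  fixes z :: "'b::{banach,real_normed_algebra_1}"
  assumes "norm z \<le> 1"
  shows "summable (\<lambda>n. norm (sqrt_coeff n *\<^sub>R z ^ n))"
proof (rule summable_comparison_test')
  show "summable (\<lambda>n. \<bar>sqrt_coeff n\<bar>)"
    using summable_abs_sqrt_coeff summable_Suc_iff[of "\<lambda>n. \<bar>sqrt_coeff n\<bar>"] by simp
qed (use norm_sqrt_term[OF assms] in auto)

lemma sums_sqrt_one_minus:
  fixes z :: "'b::{banach,real_normed_algebra_1}"
  assumes "norm z \<le> 1"
  shows "(\<lambda>n. sqrt_coeff n *\<^sub>R z ^ n) sums sqrt_one_minus z"
  unfolding sqrt_one_minus_def
  by (rule summable_sums[OF summable_norm_cancel[OF summable_norm_sqrt_one_minus[OF assms]]])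

lemma sqrt_one_minus_square:
  fixes z :: "'b::{banach,real_normed_algebra_1}"
  assumes "norm z \<le> 1"
  shows "sqrt_one_minus z * sqrt_one_minus z = 1 - z"
proof -
  note s = summable_norm_sqrt_one_minus[OF assms]
  have "(\<lambda>n. \<Sum>k\<le>n. (sqrt_coeff k *\<^sub>R z ^ k) * (sqrt_coeff (n - k) *\<^sub>R z ^ (n - k)))
      sums (sqrt_one_minus z * sqrt_one_minus z)"
    unfolding sqrt_one_minus_def by (rule Cauchy_product_sums[OF s s])
  moreover have "(\<Sum>k\<le>n. (sqrt_coeff k *\<^sub>R z ^ k) * (sqrt_coeff (n - k) *\<^sub>R z ^ (n - k)))
      = (if n = 0 then 1 else if n = 1 then - 1 else 0) *\<^sub>R z ^ n" for n
    unfolding sqrt_coeff_convolution[symmetric] scaleR_sum_left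
    by (intro sum.cong) (auto simp: power_add[symmetric])
  moreover have "(\<lambda>n. (if n = 0 then 1 else if n = 1 then - 1 else 0) *\<^sub>R z ^ n)
      sums (\<Sum>n\<in>{0,1}. (if n = 0 then 1 else if n = 1 then - 1 else 0) *\<^sub>R z ^ n)"
    by (rule sums_finite) auto
  ultimately have "sqrt_one_minus z * sqrt_one_minus z
      = (\<Sum>n\<in>{0,1}. (if n = 0 then 1 else if n = 1 then - 1 else 0) *\<^sub>R z ^ n)"
    by (simp only:) (rule sums_unique2)
  thus ?thesis by simp
qed

lemma norm_one_minus_sqrt_one_minus:
  fixes z :: "'b::{banach,real_normed_algebra_1}"
  assumes "norm z \<le> 1"
  shows "norm (1 - sqrt_one_minus z) \<le> 1"
proof -
  note s = summable_norm_sqrt_one_minus[OF assms]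
  have s': "summable (\<lambda>n. norm (sqrt_coeff (Suc n) *\<^sub>R z ^ Suc n))"
    using s by (rule summable_ignore_initial_segment[of _ 1, simplified])
  have "sqrt_one_minus z = 1 + (\<Sum>n. sqrt_coeff (Suc n) *\<^sub>R z ^ Suc n)"
    using suminf_split_head[OF summable_norm_cancel[OF s]]
    by (simp add: sqrt_one_minus_def sqrt_coeff_def[of 0])
  hence "norm (1 - sqrt_one_minus z) = norm (\<Sum>n. sqrt_coeff (Suc n) *\<^sub>R z ^ Suc n)" by simp
  also have "\<dots> \<le> (\<Sum>n. norm (sqrt_coeff (Suc n) *\<^sub>R z ^ Suc n))" by (rule summable_norm[OF s'])
  also have "\<dots> \<le> (\<Sum>n. \<bar>sqrt_coeff (Suc n)\<bar>)"
    by (intro suminf_le norm_sqrt_term assms s' summable_abs_sqrt_coeff)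
  also have "\<dots> \<le> 1"
    by (intro suminf_le_const summable_abs_sqrt_coeff sum_abs_sqrt_coeff)
  finally show ?thesis .
qed

section \<open>Closed subalgebras\<close>

text \<open>A limit of polynomials in \<open>c\<close> is described as an element of every closed unital subalgebra that
  contains \<open>c\<close>. Applied to the commutant of an element this gives commutation relations, applied to the
  closure of a set of multipliers it gives membership.\<close>

definition closed_subalgebra :: "'b::real_normed_algebra_1 set \<Rightarrow> bool" where
  "closed_subalgebra B \<longleftrightarrow> closed B \<and> 1 \<in> B \<and> (\<forall>x\<in>B. \<forall>y\<in>B. x + y \<in> B \<and> x * y \<in> B)
    \<and> (\<forall>r. \<forall>x\<in>B. r *\<^sub>R x \<in> B)"

lemma
  assumes "closed_subalgebra B"
  shows closed_subalgebra_closed: "closed B"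
    and closed_subalgebra_1: "1 \<in> B"
    and closed_subalgebra_add: "x \<in> B \<Longrightarrow> y \<in> B \<Longrightarrow> x + y \<in> B"
    and closed_subalgebra_mult: "x \<in> B \<Longrightarrow> y \<in> B \<Longrightarrow> x * y \<in> B"
    and closed_subalgebra_scaleR: "x \<in> B \<Longrightarrow> r *\<^sub>R x \<in> B"
  using assms by (auto simp: closed_subalgebra_def)

lemma closed_subalgebra_diff:
  assumes "closed_subalgebra B" "x \<in> B" "y \<in> B"
  shows "x - y \<in> B"
  using closed_subalgebra_add[OF assms(1,2) closed_subalgebra_scaleR[OF assms(1,3), of "- 1"]] by simp

lemma closed_subalgebra_power:
  assumes "closed_subalgebra B" "x \<in> B"
  shows "x ^ n \<in> B"
  by (induction n) (auto intro: closed_subalgebra_1 closed_subalgebra_mult assms)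

lemma closed_subalgebra_power_series:
  assumes B: "closed_subalgebra B" and x: "x \<in> B" and s: "(\<lambda>n. a n *\<^sub>R x ^ n) sums y"
  shows "y \<in> B"
proof (rule closed_sequentially[OF closed_subalgebra_closed[OF B]])
  show "(\<Sum>k<n. a k *\<^sub>R x ^ k) \<in> B" for n
  proof (induction n)
    case 0
    show ?case using closed_subalgebra_scaleR[OF B closed_subalgebra_1[OF B], of 0] by simp
  qed (auto intro!: closed_subalgebra_add[OF B] closed_subalgebra_scaleR[OF B] closed_subalgebra_power[OF B x])
  show "(\<lambda>n. \<Sum>k<n. a k *\<^sub>R x ^ k) \<longlonglongrightarrow> y" using s by (simp add: sums_def)
qed

lemma closed_subalgebra_sqrt_one_minus:
  fixes z :: "'b::{banach,real_normed_algebra_1}"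
  assumes "closed_subalgebra B" "z \<in> B" "norm z \<le> 1"
  shows "sqrt_one_minus z \<in> B"
  by (rule closed_subalgebra_power_series[OF assms(1,2) sums_sqrt_one_minus[OF assms(3)]])

lemma closed_subalgebra_commutant: "closed_subalgebra {x :: 'b::real_normed_algebra_1. x * c = c * x}"
  unfolding closed_subalgebra_def
proof (intro conjI ballI allI CollectI)
  show "closed {x :: 'b. x * c = c * x}" by (intro closed_Collect_eq continuous_intros)
  show "1 * c = c * 1" by simp
next
  fix x y assume "x \<in> {x. x * c = c * x}" "y \<in> {x. x * c = c * x}"
  hence xy: "x * c = c * x" "y * c = c * y" unfolding mem_Collect_eq .
  show "(x + y) * c = c * (x + y)" by (simp only: distrib_left distrib_right xy)
  have "x * y * c = x * (c * y)" by (simp only: mult.assoc xy)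
  also have "\<dots> = c * (x * y)" by (simp only: mult.assoc[symmetric] xy)
  finally show "x * y * c = c * (x * y)" .
next
  fix r x assume "x \<in> {x. x * c = c * x}"
  hence x: "x * c = c * x" unfolding mem_Collect_eq .
  show "(r *\<^sub>R x) * c = c * (r *\<^sub>R x)" by (simp only: mult_scaleR_left mult_scaleR_right x)
qed

lemma closed_subalgebra_closure:
  fixes P :: "'b::real_normed_algebra_1 set"
  assumes one: "1 \<in> P" and add: "\<And>x y. x \<in> P \<Longrightarrow> y \<in> P \<Longrightarrow> x + y \<in> P"
    and mult: "\<And>x y. x \<in> P \<Longrightarrow> y \<in> P \<Longrightarrow> x * y \<in> P" and scale: "\<And>r x. x \<in> P \<Longrightarrow> r *\<^sub>R x \<in> P"
  shows "closed_subalgebra (closure P)"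
  unfolding closed_subalgebra_def
proof (intro conjI ballI allI)
  show "1 \<in> closure P" using one closure_subset by blast
  have lim: "x \<in> closure P" if "\<And>n. X n \<in> P" "X \<longlonglongrightarrow> x" for X x
    unfolding closure_sequential using that by (intro exI[of _ X]) simp
  fix x assume "x \<in> closure P"
  then obtain X where X: "\<And>n. X n \<in> P" "X \<longlonglongrightarrow> x" unfolding closure_sequential by metis
  show "r *\<^sub>R x \<in> closure P" for r
    by (rule lim[OF scale[OF X(1)] tendsto_scaleR[OF tendsto_const X(2)]])
  fix y assume "y \<in> closure P"
  then obtain Y where Y: "\<And>n. Y n \<in> P" "Y \<longlonglongrightarrow> y" unfolding closure_sequential by metis
  show "x + y \<in> closure P" by (rule lim[OF add[OF X(1) Y(1)] tendsto_add[OF X(2) Y(2)]])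
  show "x * y \<in> closure P" by (rule lim[OF mult[OF X(1) Y(1)] tendsto_mult[OF X(2) Y(2)]])
qed simp

section \<open>Resolvents\<close>

text \<open>With \<open>z = (1 - e) / (1 + \<epsilon>)\<close> we have \<open>e + \<epsilon> = (1 + \<epsilon>) (1 - z)\<close> and \<open>\<parallel>z\<parallel> < 1\<close>, so the Neumann series
  inverts \<open>e + \<epsilon>\<close> with the same bound \<open>1 / \<epsilon>\<close> as for a positive operator. The condition
  \<open>\<parallel>1 - e\<parallel> \<le> 1\<close> thus serves as a substitute for positivity of \<open>e\<close>.\<close>

lemma resolvent:
  fixes e :: "'b::{banach,real_normed_algebra_1}"
  assumes e: "norm (1 - e) \<le> 1" and \<epsilon>: "0 < \<epsilon>"
  obtains R where "(e + \<epsilon> *\<^sub>R 1) * R = 1" "R * (e + \<epsilon> *\<^sub>R 1) = 1" "norm R \<le> 1 / \<epsilon>" "norm (e * R) \<le> 2"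
    "\<And>B. closed_subalgebra B \<Longrightarrow> e \<in> B \<Longrightarrow> R \<in> B"
proof -
  define z where "z = (1 / (1 + \<epsilon>)) *\<^sub>R (1 - e)"
  define N where "N = (\<Sum>n. z ^ n)"
  define R where "R = (1 / (1 + \<epsilon>)) *\<^sub>R N"
  have z1: "norm z \<le> 1 / (1 + \<epsilon>)" using e \<epsilon> by (simp add: z_def divide_right_mono)
  also have lt: "\<dots> < 1" using \<epsilon> by simp
  finally have z: "norm z < 1" .
  have sm: "summable (\<lambda>n. norm (z ^ n))"
    by (rule summable_comparison_test'[OF summable_geometric[of "norm z"]]) (use z norm_power_ineq in auto)
  note s = summable_norm_cancel[OF sm]
  have head: "N = 1 + (\<Sum>n. z ^ Suc n)" using suminf_split_head[OF s] by (simp add: N_def)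
  have "(\<Sum>n. z ^ Suc n) = z * N" unfolding N_def using suminf_mult[OF s, of z] by simp
  with head have l: "(1 - z) * N = 1" by (simp add: algebra_simps)
  have "(\<Sum>n. z ^ Suc n) = N * z"
    unfolding N_def using suminf_mult2[OF s, of z] by (simp add: power_Suc2 del: power_Suc)
  with head have r: "N * (1 - z) = 1" by (simp add: algebra_simps)
  have ez: "e + \<epsilon> *\<^sub>R 1 = (1 + \<epsilon>) *\<^sub>R (1 - z)"
    unfolding z_def scaleR_diff_right using \<epsilon> by (simp add: scaleR_add_left)
  have 1: "(e + \<epsilon> *\<^sub>R 1) * R = 1" "R * (e + \<epsilon> *\<^sub>R 1) = 1" unfolding ez R_def using l r \<epsilon> by simp_all
  have "norm N \<le> 1 / (1 - norm z)"
    unfolding N_def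
  proof (rule order_trans[OF summable_norm[OF sm]])
    have "(\<Sum>n. norm (z ^ n)) \<le> (\<Sum>n. norm z ^ n)"
      by (intro suminf_le norm_power_ineq sm summable_geometric) (use z in simp)
    thus "(\<Sum>n. norm (z ^ n)) \<le> 1 / (1 - norm z)" using z by (simp add: suminf_geometric)
  qed
  also have "\<dots> \<le> 1 / (1 - 1 / (1 + \<epsilon>))" using z1 lt by (intro divide_left_mono) auto
  also have "\<dots> = (1 + \<epsilon>) / \<epsilon>" using \<epsilon> by (simp add: field_simps)
  finally have 2: "norm R \<le> 1 / \<epsilon>" using \<epsilon> by (simp add: R_def field_simps)
  have "e * R = 1 - \<epsilon> *\<^sub>R R" using 1(1) by (simp add: distrib_right eq_diff_eq)
  also have "norm \<dots> \<le> norm (1::'b) + norm (\<epsilon> *\<^sub>R R)" by (rule norm_triangle_ineq4)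
  also have "\<dots> \<le> 2" using 2 \<epsilon> by (simp add: field_simps)
  finally have 3: "norm (e * R) \<le> 2" .
  have "R \<in> B" if B: "closed_subalgebra B" "e \<in> B" for B
  proof -
    have "z \<in> B" unfolding z_def
      by (intro closed_subalgebra_scaleR closed_subalgebra_diff closed_subalgebra_1 B)
    moreover have "(\<lambda>n. 1 *\<^sub>R z ^ n) sums N" using summable_sums[OF s] by (simp add: N_def)
    ultimately have "N \<in> B" by (rule closed_subalgebra_power_series[OF B(1)])
    thus "R \<in> B" unfolding R_def by (rule closed_subalgebra_scaleR[OF B(1)])
  qed
  with 1 2 3 show thesis using that by blast
qed

section \<open>Unital C*-algebras\<close>

class cstar_algebra_1 = cstar_algebra + real_normed_algebra_1

lemma scaleC_diff_right: "c *\<^sub>C (x - y) = c *\<^sub>C x - c *\<^sub>C (y :: 'a::complex_vector)"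
  using scaleC_add_right[of c x "- y"] by (simp add: scaleC_minus_right)

lemma star_zero [simp]: "star (0 :: 'a::cstar_algebra) = 0"
  using star_add[of "0 :: 'a" 0] by simp

lemma star_minus: "star (- a) = - star (a :: 'a::cstar_algebra)"
  using star_add[of a "- a"] by (simp add: eq_neg_iff_add_eq_0 add.commute)

lemma star_diff: "star (a - b) = star a - star (b :: 'a::cstar_algebra)"
  using star_add[of a "- b"] by (simp add: star_minus)

lemma star_scaleR: "star (r *\<^sub>R a) = r *\<^sub>R star (a :: 'a::cstar_algebra)"
  using star_scaleC[of "complex_of_real r" a] by (simp add: scaleC_of_real)

lemma norm_star_le: "norm (a :: 'a::cstar_algebra) \<le> norm (star a)"
proof (cases "a = 0")
  case False
  have "norm a * norm a = norm (star a * a)" by (simp add: cstar_norm power2_eq_square)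
  also have "\<dots> \<le> norm (star a) * norm a" by (rule norm_mult_ineq)
  finally show ?thesis using False by simp
qed simp

lemma norm_star [simp]: "norm (star a) = norm (a :: 'a::cstar_algebra)"
  using norm_star_le[of a] norm_star_le[of "star a"] by (simp add: star_star)

lemma bounded_linear_star: "bounded_linear (star :: 'a::cstar_algebra \<Rightarrow> 'a)"
  by (rule bounded_linear_intro[where K = 1]) (simp_all add: star_add star_scaleR)

lemma norm_selfadjoint_square:
  assumes "star h = (h :: 'a::cstar_algebra)"
  shows "norm (h * h) = (norm h)\<^sup>2"
  using cstar_norm[of h] assms by simp

lemma star_one [simp]: "star 1 = (1 :: 'a::cstar_algebra_1)"
  by (metis mult.left_neutral mult.right_neutral star_mult star_star)

lemma star_power: "star (a ^ n) = star a ^ n" for a :: "'a::cstar_algebra_1"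
  by (induction n) (simp_all add: star_mult power_commutes)

lemma star_sqrt_one_minus:
  fixes z :: "'a::cstar_algebra_1"
  assumes "norm z \<le> 1" and sa: "star z = z"
  shows "star (sqrt_one_minus z) = sqrt_one_minus z"
proof -
  have "(\<lambda>n. star (sqrt_coeff n *\<^sub>R z ^ n)) sums star (sqrt_one_minus z)"
    by (rule bounded_linear.sums[OF bounded_linear_star sums_sqrt_one_minus[OF assms(1)]])
  hence "(\<lambda>n. sqrt_coeff n *\<^sub>R z ^ n) sums star (sqrt_one_minus z)"
    by (simp add: star_scaleR star_power sa)
  thus ?thesis using sums_sqrt_one_minus[OF assms(1)] by (rule sums_unique2)
qed

text \<open>This replaces the statement that \<open>c\<^sup>2\<close> has spectrum in \<open>[0, 1]\<close>. With \<open>s = \<surd>(1 - c\<^sup>2)\<close> the element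
  \<open>u = c + \<i> s\<close> is unitary, so its imaginary part \<open>s\<close> is a contraction, and so is \<open>s\<^sup>2 = 1 - c\<^sup>2\<close>.\<close>

lemma norm_one_minus_square:
  fixes c :: "'a::cstar_algebra_1"
  assumes sa: "star c = c" and c: "norm c \<le> 1"
  shows "norm (1 - c * c) \<le> 1"
proof -
  have cc: "norm (c * c) \<le> 1" using c norm_selfadjoint_square[OF sa] by (simp add: power_le_one)
  define s where "s = sqrt_one_minus (c * c)"
  have s2: "s * s = 1 - c * c" unfolding s_def by (rule sqrt_one_minus_square[OF cc])
  have s: "star s = s" unfolding s_def by (rule star_sqrt_one_minus[OF cc]) (simp add: star_mult sa)
  have com: "s * c = c * s"
    using closed_subalgebra_sqrt_one_minus[OF closed_subalgebra_commutant _ cc, of c]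
    by (simp add: s_def mult.assoc)
  define u where "u = c + \<i> *\<^sub>C s"
  have su: "star u = c - \<i> *\<^sub>C s"
  proof -
    have "star u = c + (- \<i>) *\<^sub>C s" by (simp add: u_def star_add star_scaleC s sa)
    moreover have "(- \<i>) *\<^sub>C s = - (\<i> *\<^sub>C s)"
      using scaleC_add_left[of "- \<i>" \<i> s] scaleC_of_real[of 0 s] by (simp add: eq_neg_iff_add_eq_0)
    ultimately show ?thesis by simp
  qed
  have ii: "\<i> *\<^sub>C \<i> *\<^sub>C x = - x" for x :: 'a
    using scaleC_of_real[of "- 1" x] by (simp add: scaleC_scaleC)
  have "star u * u = 1"
    unfolding su unfolding u_def
    by (simp add: algebra_simps scaleC_add_right scaleC_diff_right scaleC_mult_left scaleC_mult_right ii s2 com)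
  hence "(norm u)\<^sup>2 = 1" using cstar_norm[of u] by simp
  hence u: "norm u = 1" by (simp add: power2_eq_1_iff) (metis norm_ge_zero not_one_le_zero neg_0_le_iff_le)
  have "u - star u = 2 *\<^sub>R (\<i> *\<^sub>C s)" unfolding su unfolding u_def by (simp add: scaleR_2)
  hence "2 * norm s = norm (u - star u)" by (simp add: norm_scaleC)
  also have "\<dots> \<le> 2" using norm_triangle_ineq4[of u "star u"] u by simp
  finally have "norm s \<le> 1" by simp
  hence "norm (s * s) \<le> 1" by (simp add: norm_selfadjoint_square[OF s] power_le_one)
  thus ?thesis by (simp add: s2)
qed

text \<open>The hypotheses on \<open>g\<close> are reproduced by its root \<open>f\<close>, which allows iteration.\<close>

lemma selfadjoint_square_root:
  fixes g :: "'a::cstar_algebra_1"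
  assumes g: "star g = g" "norm (1 - g) \<le> 1"
  obtains f where "star f = f" "norm (1 - f) \<le> 1" "f\<^sup>2 = g"
    "\<And>B. closed_subalgebra B \<Longrightarrow> g \<in> B \<Longrightarrow> f \<in> B"
proof
  let ?f = "sqrt_one_minus (1 - g)"
  show "?f\<^sup>2 = g" using sqrt_one_minus_square[OF g(2)] by (simp add: power2_eq_square)
  show "star ?f = ?f" by (rule star_sqrt_one_minus[OF g(2)]) (simp add: star_diff g(1))
  show "norm (1 - ?f) \<le> 1" by (rule norm_one_minus_sqrt_one_minus[OF g(2)])
  show "?f \<in> B" if "closed_subalgebra B" "g \<in> B" for B
    using that(2) closed_subalgebra_1[OF that(1)] g(2)
    by (intro closed_subalgebra_sqrt_one_minus closed_subalgebra_diff that(1))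
qed

lemma selfadjoint_root:
  fixes c :: "'a::cstar_algebra_1"
  assumes sa: "star c = c" and c: "norm c \<le> 1"
  obtains f where "star f = f" "norm (1 - f) \<le> 1" "f ^ (2 ^ m) = c\<^sup>2"
    "\<And>B. closed_subalgebra B \<Longrightarrow> c \<in> B \<Longrightarrow> f \<in> B"
proof -
  have "\<exists>f. star f = f \<and> norm (1 - f) \<le> 1 \<and> f ^ (2 ^ m) = c\<^sup>2
      \<and> (\<forall>B. closed_subalgebra B \<longrightarrow> c \<in> B \<longrightarrow> f \<in> B)"
  proof (induction m)
    case 0
    show ?case using norm_one_minus_square[OF sa c]
      by (intro exI[of _ "c\<^sup>2"]) (auto simp: star_mult sa power2_eq_square intro: closed_subalgebra_mult)
  next
    case (Suc m)
    then obtain g where g: "star g = g" "norm (1 - g) \<le> 1" "g ^ (2 ^ m) = c\<^sup>2"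
      "\<And>B. closed_subalgebra B \<Longrightarrow> c \<in> B \<Longrightarrow> g \<in> B" by blast
    obtain f where f: "star f = f" "norm (1 - f) \<le> 1" "f\<^sup>2 = g"
      "\<And>B. closed_subalgebra B \<Longrightarrow> g \<in> B \<Longrightarrow> f \<in> B"
      using selfadjoint_square_root[OF g(1,2)] by blast
    have "f ^ (2 ^ Suc m) = c\<^sup>2" using f(3) g(3) by (simp add: power_mult)
    thus ?case using f g by blast
  qed
  thus thesis using that by blast
qed

section \<open>The unitization of a C*-algebra\<close>

text \<open>The norm of \<open>\<lambda> + a\<close> is the maximum of \<open>\<bar>\<lambda>\<bar>\<close> and of the norm of the operator \<open>b \<mapsto> \<lambda> b + a b\<close> on
  \<open>A\<close>. The operator norm alone would vanish on \<open>1 - e\<close> if \<open>A\<close> had a unit \<open>e\<close>; the maximum is a C*-norm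
  in all cases, because both seminorms satisfy the C*-identity and only 0 is annihilated by both.\<close>

datatype 'a unitization = Unitization (scalar_part: complex) (algebra_part: 'a)

instantiation unitization :: (cstar_algebra) complex_vector
begin

definition "0 = Unitization 0 0"
definition "x + y = Unitization (scalar_part x + scalar_part y) (algebra_part x + algebra_part y)"
definition "x - y = Unitization (scalar_part x - scalar_part y) (algebra_part x - algebra_part y)"
definition "- x = Unitization (- scalar_part x) (- algebra_part x)"
definition "r *\<^sub>R x = Unitization (r *\<^sub>R scalar_part x) (r *\<^sub>R algebra_part x)"
definition "c *\<^sub>C x = Unitization (c * scalar_part x) (c *\<^sub>C algebra_part x)"

instance
  by standard
    (simp_all add: zero_unitization_def plus_unitization_def minus_unitization_def
      uminus_unitization_def scaleR_unitization_def scaleC_unitization_def algebra_simps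
      scaleC_add_left scaleC_add_right scaleC_scaleC scaleC_of_real scaleR_conv_of_real)

end

lemma unitization_sel [simp]:
  "scalar_part 0 = 0" "algebra_part (0 :: 'a unitization) = 0"
  "scalar_part (x + y) = scalar_part x + scalar_part y"
  "algebra_part (x + y) = algebra_part x + algebra_part (y :: 'a::cstar_algebra unitization)"
  "scalar_part (x - y) = scalar_part x - scalar_part y"
  "algebra_part (x - y) = algebra_part x - algebra_part y"
  "scalar_part (- x) = - scalar_part x" "algebra_part (- x) = - algebra_part x"
  "scalar_part (r *\<^sub>R x) = r *\<^sub>R scalar_part x" "algebra_part (r *\<^sub>R x) = r *\<^sub>R algebra_part x"
  "scalar_part (c *\<^sub>C x) = c * scalar_part x" "algebra_part (c *\<^sub>C x) = c *\<^sub>C algebra_part x"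
  by (simp_all add: zero_unitization_def plus_unitization_def minus_unitization_def
      uminus_unitization_def scaleR_unitization_def scaleC_unitization_def)

lemma unitization_eqI:
  "scalar_part x = scalar_part y \<Longrightarrow> algebra_part x = algebra_part y \<Longrightarrow> x = y"
  by (rule unitization.expand) simp

lemma scaleC_zero_left [simp]: "0 *\<^sub>C (x :: 'a::complex_vector) = 0"
  using scaleC_of_real[of 0 x] by simp

lemma scaleC_one [simp]: "1 *\<^sub>C (x :: 'a::complex_vector) = x"
  using scaleC_of_real[of 1 x] by simp

definition left_mult :: "'a unitization \<Rightarrow> 'a \<Rightarrow> 'a::cstar_algebra" where
  "left_mult u b = scalar_part u *\<^sub>C b + algebra_part u * b"

lemma bounded_linear_left_mult: "bounded_linear (left_mult u)"
  unfolding left_mult_def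
  by (intro bounded_linear_add bounded_linear_scaleC bounded_linear_mult_right)

lemma left_mult_add: "left_mult (u + v) b = left_mult u b + left_mult v b"
  by (simp add: left_mult_def scaleC_add_left algebra_simps)

lemma left_mult_scaleC: "left_mult (c *\<^sub>C u) b = c *\<^sub>C left_mult u b"
  by (simp add: left_mult_def scaleC_add_right scaleC_scaleC scaleC_mult_left)

definition operator_norm :: "'a::cstar_algebra unitization \<Rightarrow> real" where
  "operator_norm u = onorm (left_mult u)"

lemma operator_norm_nonneg: "0 \<le> operator_norm u"
  unfolding operator_norm_def by (rule onorm_pos_le[OF bounded_linear_left_mult])

lemma norm_left_mult: "norm (left_mult u b) \<le> operator_norm u * norm b"
  unfolding operator_norm_def by (rule onorm[OF bounded_linear_left_mult])

lemma operator_norm_le: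
  "0 \<le> K \<Longrightarrow> (\<And>b. norm (left_mult u b) \<le> K * norm b) \<Longrightarrow> operator_norm u \<le> K"
  unfolding operator_norm_def by (rule onorm_bound)

lemma operator_norm_triangle: "operator_norm (u + v) \<le> operator_norm u + operator_norm v"
proof (rule operator_norm_le)
  fix b
  have "norm (left_mult (u + v) b) \<le> norm (left_mult u b) + norm (left_mult v b)"
    unfolding left_mult_add by (rule norm_triangle_ineq)
  thus "norm (left_mult (u + v) b) \<le> (operator_norm u + operator_norm v) * norm b"
    using norm_left_mult[of u b] norm_left_mult[of v b] by (simp add: distrib_right)
qed (simp add: operator_norm_nonneg)

lemma operator_norm_scaleC_le: "operator_norm (c *\<^sub>C u) \<le> cmod c * operator_norm u"
  by (rule operator_norm_le)
    (simp_all add: operator_norm_nonneg left_mult_scaleC norm_scaleC norm_left_mult mult.assoc mult_left_mono)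

lemma operator_norm_scaleC: "operator_norm (c *\<^sub>C u) = cmod c * operator_norm u"
proof (rule antisym[OF operator_norm_scaleC_le])
  show "cmod c * operator_norm u \<le> operator_norm (c *\<^sub>C u)"
  proof (cases "c = 0")
    case False
    have "operator_norm (inverse c *\<^sub>C c *\<^sub>C u) \<le> cmod (inverse c) * operator_norm (c *\<^sub>C u)"
      by (rule operator_norm_scaleC_le)
    thus ?thesis using False by (simp add: scaleC_scaleC norm_divide field_simps)
  qed (simp add: operator_norm_nonneg)
qed

text \<open>The operator of left multiplication by \<open>a\<close> attains its norm at \<open>a\<^sup>*\<close>, by the C*-identity.\<close>

lemma operator_norm_algebra: "operator_norm (Unitization 0 a) = norm a"
proof (rule antisym)
  show "operator_norm (Unitization 0 a) \<le> norm a"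
    by (rule operator_norm_le) (simp_all add: left_mult_def norm_mult_ineq)
  have "norm (a * star a) = norm a * norm a"
    using cstar_norm[of "star a"] by (simp add: star_star power2_eq_square)
  moreover have "norm (a * star a) \<le> operator_norm (Unitization 0 a) * norm a"
    using norm_left_mult[of "Unitization 0 a" "star a"] by (simp add: left_mult_def)
  ultimately show "norm a \<le> operator_norm (Unitization 0 a)"
    using operator_norm_nonneg[of "Unitization 0 a"] by (cases "a = 0") auto
qed

lemma operator_norm_scalar: "operator_norm (Unitization c 0) \<le> cmod c"
  by (rule operator_norm_le) (simp_all add: left_mult_def norm_scaleC)

lemma unitization_split: "u = Unitization (scalar_part u) 0 + Unitization 0 (algebra_part u)"
  by (rule unitization_eqI) simp_all

lemma norm_algebra_part_le:
  fixes u :: "'a::cstar_algebra unitization"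
  shows "norm (algebra_part u) \<le> cmod (scalar_part u) + operator_norm u"
proof -
  have "Unitization 0 (algebra_part u) = u + Unitization (- scalar_part u) (0 :: 'a)"
    by (rule unitization_eqI) simp_all
  hence "norm (algebra_part u) = operator_norm (u + Unitization (- scalar_part u) (0 :: 'a))"
    by (metis operator_norm_algebra)
  also have "\<dots> \<le> operator_norm u + operator_norm (Unitization (- scalar_part u) (0 :: 'a))"
    by (rule operator_norm_triangle)
  finally have "norm (algebra_part u) \<le> operator_norm u + operator_norm (Unitization (- scalar_part u) (0 :: 'a))" .
  thus ?thesis using operator_norm_scalar[of "- scalar_part u", where 'a = 'a] by simp
qed

lemma operator_norm_le_parts:
  fixes u :: "'a::cstar_algebra unitization"
  shows "operator_norm u \<le> cmod (scalar_part u) + norm (algebra_part u)"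
  using operator_norm_triangle[of "Unitization (scalar_part u) (0 :: 'a)" "Unitization 0 (algebra_part u)"]
    operator_norm_scalar[of "scalar_part u", where 'a = 'a]
  unfolding unitization_split[of u, symmetric] operator_norm_algebra by linarith

instantiation unitization :: (cstar_algebra) real_normed_vector
begin

definition "norm u = max (cmod (scalar_part u)) (operator_norm u)"
definition "dist u v = norm (u - v :: 'a unitization)"
definition "sgn u = inverse (norm u) *\<^sub>R (u :: 'a unitization)"
definition
  "uniformity = (INF e\<in>{0<..}. principal {(x, y :: 'a unitization). dist x y < e})"
definition
  "open U = (\<forall>x\<in>U. eventually (\<lambda>(x', y). x' = x \<longrightarrow> y \<in> (U :: 'a unitization set)) uniformity)"

instance
proof
  fix u v :: "'a unitization" and r :: real
  show "(norm u = 0) = (u = 0)"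
  proof
    assume "norm u = 0"
    hence *: "cmod (scalar_part u) \<le> 0" "operator_norm u \<le> 0"
      unfolding norm_unitization_def by linarith+
    hence "norm (algebra_part u) \<le> 0" using norm_algebra_part_le[of u] by linarith
    thus "u = 0" using * by (intro unitization_eqI) auto
  next
    assume "u = 0"
    thus "norm u = 0" using operator_norm_scalar[of 0, where 'a = 'a] operator_norm_nonneg[of u]
      by (simp add: norm_unitization_def zero_unitization_def)
  qed
  show "norm (u + v) \<le> norm u + norm v"
    using operator_norm_triangle[of u v] norm_triangle_ineq[of "scalar_part u" "scalar_part v"]
    unfolding norm_unitization_def unitization_sel by linarith
  show "norm (r *\<^sub>R u) = \<bar>r\<bar> * norm u"
    using operator_norm_scaleC[of "complex_of_real r" u]
    by (simp add: norm_unitization_def scaleC_of_real max_mult_distrib_left)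
qed (simp_all add: dist_unitization_def sgn_unitization_def uniformity_unitization_def open_unitization_def)

end

lemma norm_parts_le: "cmod (scalar_part u) \<le> norm u" "norm (algebra_part u) \<le> 2 * norm u"
  using norm_algebra_part_le[of u] by (auto simp: norm_unitization_def)

lemma norm_unitization_le_parts: "norm u \<le> cmod (scalar_part u) + norm (algebra_part u)"
  using operator_norm_le_parts[of u] by (simp add: norm_unitization_def)

instance unitization :: (cstar_algebra) banach
proof
  fix X :: "nat \<Rightarrow> 'a unitization" assume X: "Cauchy X"
  have s: "bounded_linear (scalar_part :: 'a unitization \<Rightarrow> complex)"
    by (rule bounded_linear_intro[where K = 1]) (simp_all add: norm_parts_le)
  have a: "bounded_linear (algebra_part :: 'a unitization \<Rightarrow> 'a)"
    by (rule bounded_linear_intro[where K = 2]) (use norm_parts_le(2) in \<open>simp_all add: mult.commute\<close>)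
  obtain l where l: "(\<lambda>n. scalar_part (X n)) \<longlonglongrightarrow> l"
    using bounded_linear.Cauchy[OF s X] Cauchy_convergent convergent_def by blast
  obtain b where b: "(\<lambda>n. algebra_part (X n)) \<longlonglongrightarrow> b"
    using bounded_linear.Cauchy[OF a X] Cauchy_convergent convergent_def by blast
  have "(\<lambda>n. cmod (scalar_part (X n) - l) + norm (algebra_part (X n) - b)) \<longlonglongrightarrow> 0"
    using tendsto_add[OF tendsto_norm_zero[OF LIM_zero[OF l]] tendsto_norm_zero[OF LIM_zero[OF b]]] by simp
  hence "(\<lambda>n. X n - Unitization l b) \<longlonglongrightarrow> 0"
    by (rule Lim_null_comparison[rotated])
      (use norm_unitization_le_parts[of "X _ - Unitization l b"] in \<open>simp add: eventually_sequentially\<close>)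
  thus "convergent X" using LIM_zero_cancel convergentI by blast
qed

instance unitization :: (cstar_algebra) complex_banach
  by standard (simp add: norm_unitization_def operator_norm_scaleC norm_mult max_mult_distrib_left)

instantiation unitization :: (cstar_algebra) cstar_algebra_1
begin

definition "1 = Unitization 1 0"
definition "u * v = Unitization (scalar_part u * scalar_part v)
  (scalar_part u *\<^sub>C algebra_part v + scalar_part v *\<^sub>C algebra_part u + algebra_part u * algebra_part v)"
definition "star u = Unitization (cnj (scalar_part u)) (star (algebra_part u))"

lemma left_mult_mult: "left_mult (u * v) b = left_mult u (left_mult v b)" for u v :: "'a unitization"
  by (simp add: left_mult_def times_unitization_def algebra_simps scaleC_add_right scaleC_scaleC
      scaleC_mult_left scaleC_mult_right)

lemma left_mult_star: "star (left_mult u x) * y = star x * left_mult (star u) y" for u :: "'a unitization"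
  by (simp add: left_mult_def star_unitization_def algebra_simps star_add star_scaleC star_mult
      scaleC_mult_left scaleC_mult_right)

lemma operator_norm_mult: "operator_norm (u * v) \<le> operator_norm u * operator_norm v" for u v :: "'a unitization"
proof (rule operator_norm_le)
  fix b
  have "norm (left_mult (u * v) b) \<le> operator_norm u * norm (left_mult v b)"
    unfolding left_mult_mult by (rule norm_left_mult)
  also have "\<dots> \<le> operator_norm u * (operator_norm v * norm b)"
    by (intro mult_left_mono norm_left_mult operator_norm_nonneg)
  finally show "norm (left_mult (u * v) b) \<le> operator_norm u * operator_norm v * norm b"
    by (simp add: mult.assoc)
qed (simp add: operator_norm_nonneg)

text \<open>The C*-identity for operators on \<open>A\<close> is inherited from that of \<open>A\<close>:
  \<open>\<parallel>u b\<parallel>\<^sup>2 = \<parallel>b\<^sup>* (u\<^sup>* u b)\<parallel> \<le> \<parallel>u\<^sup>* u\<parallel> \<parallel>b\<parallel>\<^sup>2\<close>.\<close>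

lemma operator_norm_square_le: "(operator_norm u)\<^sup>2 \<le> operator_norm (star u * u)" for u :: "'a unitization"
proof -
  let ?K = "operator_norm (star u * u)"
  have K: "?K \<ge> 0" by (rule operator_norm_nonneg)
  have "operator_norm u \<le> sqrt ?K"
  proof (rule operator_norm_le)
    fix b
    have "(norm (left_mult u b))\<^sup>2 = norm (star b * left_mult (star u * u) b)"
      by (simp add: cstar_norm[symmetric] left_mult_star left_mult_mult)
    also have "\<dots> \<le> norm b * norm (left_mult (star u * u) b)"
      using norm_mult_ineq[of "star b"] by simp
    also have "\<dots> \<le> norm b * (?K * norm b)" by (intro mult_left_mono norm_left_mult) simp
    also have "\<dots> = (sqrt ?K * norm b)\<^sup>2" using K by (simp add: power_mult_distrib power2_eq_square)
    finally show "norm (left_mult u b) \<le> sqrt ?K * norm b" by (rule power2_le_imp_le) (use K in simp)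
  qed (use K in simp)
  hence "(operator_norm u)\<^sup>2 \<le> (sqrt ?K)\<^sup>2" by (intro power_mono operator_norm_nonneg)
  thus ?thesis using K by simp
qed

lemma operator_norm_le_star: "operator_norm u \<le> operator_norm (star u)" for u :: "'a unitization"
proof (cases "operator_norm u = 0")
  case False
  have "operator_norm u * operator_norm u \<le> operator_norm (star u) * operator_norm u"
    using operator_norm_square_le[of u] operator_norm_mult[of "star u" u] by (simp add: power2_eq_square)
  thus ?thesis using False operator_norm_nonneg[of u] by simp
qed (simp add: operator_norm_nonneg)

lemma unitization_star_star: "star (star u) = (u :: 'a unitization)"
  by (rule unitization_eqI) (simp_all add: star_unitization_def star_star)

lemma operator_norm_cstar: "operator_norm (star u * u) = (operator_norm u)\<^sup>2" for u :: "'a unitization"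
proof (rule antisym[OF _ operator_norm_square_le])
  have "operator_norm (star u) = operator_norm u"
    using operator_norm_le_star[of u] operator_norm_le_star[of "star u"] by (simp add: unitization_star_star)
  thus "operator_norm (star u * u) \<le> (operator_norm u)\<^sup>2"
    using operator_norm_mult[of "star u" u] by (simp add: power2_eq_square)
qed

instance
proof
  fix u v w :: "'a unitization" and c :: complex and r :: real
  show "star (star u) = u" by (rule unitization_star_star)
  show "norm (u * v) \<le> norm u * norm v"
  proof -
    have "cmod (scalar_part (u * v)) \<le> norm u * norm v"
      by (simp add: times_unitization_def norm_mult mult_mono norm_parts_le)
    moreover have "operator_norm (u * v) \<le> norm u * norm v"
      by (rule order_trans[OF operator_norm_mult])
        (intro mult_mono, simp_all add: norm_unitization_def operator_norm_nonneg le_max_iff_disj)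
    ultimately show ?thesis by (simp add: norm_unitization_def)
  qed
  show "norm (star u * u) = (norm u)\<^sup>2"
  proof -
    have "cmod (scalar_part (star u * u)) = (cmod (scalar_part u))\<^sup>2"
      by (simp add: times_unitization_def star_unitization_def norm_mult power2_eq_square)
    hence "norm (star u * u) = max ((cmod (scalar_part u))\<^sup>2) ((operator_norm u)\<^sup>2)"
      by (simp add: norm_unitization_def operator_norm_cstar)
    also have "\<dots> = (norm u)\<^sup>2"
      using operator_norm_nonneg[of u] by (auto simp: norm_unitization_def max_def power_mono_iff)
    finally show ?thesis .
  qed
  show "0 \<noteq> (1 :: 'a unitization)" by (simp add: one_unitization_def zero_unitization_def)
  show "norm (1 :: 'a unitization) = 1"
    using operator_norm_scalar[of 1, where 'a = 'a] by (simp add: norm_unitization_def one_unitization_def)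
qed (rule unitization_eqI; simp add: times_unitization_def one_unitization_def star_unitization_def algebra_simps
      scaleC_add_left scaleC_add_right scaleC_scaleC scaleC_mult_left scaleC_mult_right star_add star_scaleC
      star_mult scaleR_conv_of_real scaleC_of_real[symmetric])+

end

lemma unitization_mult_sel [simp]:
  "scalar_part 1 = 1" "algebra_part (1 :: 'a unitization) = 0"
  "scalar_part (u * v) = scalar_part u * scalar_part v"
  "algebra_part (u * v) = scalar_part u *\<^sub>C algebra_part v + scalar_part v *\<^sub>C algebra_part u
    + algebra_part u * algebra_part (v :: 'a::cstar_algebra unitization)"
  "scalar_part (star u) = cnj (scalar_part u)" "algebra_part (star u) = star (algebra_part u)"
  by (simp_all add: one_unitization_def times_unitization_def star_unitization_def)

lemma scalar_part_power: "scalar_part (u ^ n) = scalar_part u ^ n" for u :: "'a::cstar_algebra unitization"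
  by (induction n) simp_all

section \<open>Factorization in Hilbert modules\<close>

context hilbert_module
begin

lemma ip_act_left: "\<langle>x \<cdot> a, y\<rangle> = star a * \<langle>x, y\<rangle>"
  by (metis ip_commute ip_act_right star_mult)

lemma act_scaleR_right: "x \<cdot> (r *\<^sub>R a) = r *\<^sub>R (x \<cdot> a)"
  using act_scaleC_right[of x "complex_of_real r" a] by (simp add: scaleC_of_real)

lemma act_scaleR_left: "(r *\<^sub>R x) \<cdot> a = r *\<^sub>R (x \<cdot> a)"
  using act_scaleC_left[of "complex_of_real r" x a] by (simp add: scaleC_of_real)

lemma act_zero_right [simp]: "x \<cdot> 0 = 0"
  using act_add_right[of x 0 0] by simp

lemma act_diff_right: "x \<cdot> (a - b) = x \<cdot> a - x \<cdot> b"
  using act_add_right[of x "a - b" b] by (simp add: eq_diff_eq)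

lemma norm_square_ip: "(norm x)\<^sup>2 = norm \<langle>x, x\<rangle>"
  by (simp add: norm_ip)

lemma norm_act_le: "norm (x \<cdot> a) \<le> norm x * norm a"
proof (rule power2_le_imp_le)
  have "(norm (x \<cdot> a))\<^sup>2 = norm (star a * \<langle>x, x\<rangle> * a)"
    by (simp add: norm_square_ip ip_act_left ip_act_right mult.assoc)
  also have "\<dots> \<le> norm (star a) * norm \<langle>x, x\<rangle> * norm a"
    by (intro order_trans[OF norm_mult_ineq] mult_right_mono norm_mult_ineq) simp
  also have "\<dots> = (norm x * norm a)\<^sup>2" by (simp add: norm_square_ip[symmetric] power2_eq_square)
  finally show "(norm (x \<cdot> a))\<^sup>2 \<le> (norm x * norm a)\<^sup>2" .
qed simp

lemma bounded_linear_act_left: "bounded_linear (\<lambda>x. x \<cdot> a)"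
  by (rule bounded_linear_intro[where K = "norm a"]) (simp_all add: act_add_left act_scaleR_left norm_act_le)

end

lemma power_mult_commuting:
  fixes x y :: "'a::monoid_mult"
  assumes "x * y = y * x"
  shows "(x * y) ^ n = x ^ n * y ^ n"
proof (induction n)
  case (Suc n)
  have "(x * y) ^ Suc n = x * (y * x ^ n) * y ^ n" by (simp add: Suc mult.assoc)
  also have "y * x ^ n = x ^ n * y" using power_commuting_commutes[OF assms, of n] by simp
  finally show ?case by (simp add: mult.assoc)
qed simp

text \<open>With \<open>c = \<langle>x, x\<rangle>\<close> and \<open>R\<^sub>\<epsilon> = (e + \<epsilon>)\<^sup>-\<^sup>1\<close>, the resolvent identity gives
  \<open>x R\<^sub>\<epsilon> - x R\<^sub>\<delta> = (\<delta> - \<epsilon>) x R\<^sub>\<epsilon> R\<^sub>\<delta>\<close>. The vectors \<open>x R\<^sub>\<epsilon> R\<^sub>\<delta>\<close> are bounded, since by the C*-identity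
  \<open>\<parallel>x q\<parallel>^4 = \<parallel>c\<^sup>2 q^4\<parallel>\<close> for self-adjoint \<open>q\<close> commuting with \<open>c\<close>, while \<open>c\<^sup>2\<close> is a multiple of \<open>e^8\<close>, which
  absorbs the four factors \<open>R\<^sub>\<epsilon>\<close> and the four factors \<open>R\<^sub>\<delta>\<close>, each \<open>e R\<^sub>\<epsilon>\<close> having norm at most 2. So
  \<open>x R\<^sub>\<epsilon>\<close> converges as \<open>\<epsilon> \<rightarrow> 0\<close>, and its limit \<open>y\<close> satisfies \<open>y e = x\<close>.\<close>

lemma factorization_unital:
  fixes act :: "'x::complex_banach \<Rightarrow> 'a::cstar_algebra_1 \<Rightarrow> 'x" (infixl "\<cdot>" 75)
    and ip :: "'x \<Rightarrow> 'x \<Rightarrow> 'a"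
  assumes "hilbert_module act ip" and act_one: "\<And>x. x \<cdot> 1 = x"
    and e: "star e = e" "norm (1 - e) \<le> 1" and com: "e * ip x x = ip x x * e"
    and pow: "e ^ 8 = K *\<^sub>R (ip x x)\<^sup>2" and K: "0 < K"
  obtains y where "x = y \<cdot> e"
proof -
  interpret hilbert_module act ip by fact
  define \<epsilon> where "\<epsilon> n = 1 / real (Suc n)" for n
  have \<epsilon>: "0 < \<epsilon> n" for n by (simp add: \<epsilon>_def)
  have \<epsilon>0: "\<epsilon> \<longlonglongrightarrow> 0" unfolding \<epsilon>_def by (rule LIMSEQ_Suc[OF lim_1_over_n])
  have "\<exists>R. \<forall>n. (e + \<epsilon> n *\<^sub>R 1) * R n = 1 \<and> R n * (e + \<epsilon> n *\<^sub>R 1) = 1 \<and> norm (e * R n) \<le> 2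
      \<and> (\<forall>B. closed_subalgebra B \<longrightarrow> e \<in> B \<longrightarrow> R n \<in> B)"
    by (rule choice) (use resolvent[OF e(2) \<epsilon>] in metis)
  then obtain R where R: "\<And>n. (e + \<epsilon> n *\<^sub>R 1) * R n = 1" "\<And>n. R n * (e + \<epsilon> n *\<^sub>R 1) = 1"
    "\<And>n. norm (e * R n) \<le> 2" "\<And>n B. closed_subalgebra B \<Longrightarrow> e \<in> B \<Longrightarrow> R n \<in> B" by metis
  have Rcom: "R n * z = z * R n" if "e * z = z * e" for n z
    using R(4)[OF closed_subalgebra_commutant[of z], of n] that by simp
  have Re: "R n * e = e * R n" for n by (rule Rcom) simp
  have RR: "R n * R m = R m * R n" for n m by (rule Rcom) (rule Re[symmetric])
  have Rsa: "star (R n) = R n" for n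
  proof -
    have "star (R n) * (e + \<epsilon> n *\<^sub>R 1) = 1"
      using arg_cong[OF R(1)[of n], of star] by (simp add: star_mult star_add star_scaleR e(1))
    hence "star (R n) * ((e + \<epsilon> n *\<^sub>R 1) * R n) = R n" by (simp add: mult.assoc[symmetric])
    thus ?thesis by (simp add: R(1))
  qed
  \<comment> \<open>The bound \<open>256 = 2^8\<close> on a fourth power; adding 1 avoids extracting the root.\<close>
  define M where "M = 1 + 256 / K"
  have M: "norm (x \<cdot> (R n * R m)) \<le> M" for n m
  proof -
    define q where "q = R n * R m"
    define c where "c = ip x x"
    have cR: "R n * c = c * R n" for n unfolding c_def by (rule Rcom[OF com])
    have q: "star q = q" by (simp add: q_def star_mult Rsa RR)
    have qc: "q * c = c * q" unfolding q_def by (metis cR mult.assoc)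
    have qe: "q * e = e * q" unfolding q_def by (metis Re mult.assoc)
    have c: "star c = c" unfolding c_def by (rule ip_commute[symmetric])
    have h: "star (c * q\<^sup>2) = c * q\<^sup>2"
      unfolding power2_eq_square star_mult c q by (metis qc mult.assoc)
    have "ip (x \<cdot> q) (x \<cdot> q) = q * c * q"
      by (simp add: ip_act_left ip_act_right q c_def mult.assoc)
    also have "\<dots> = c * q\<^sup>2" by (simp add: qc power2_eq_square mult.assoc)
    finally have "(norm (x \<cdot> q))\<^sup>2 = norm (c * q\<^sup>2)" by (simp add: norm_square_ip)
    hence "norm (x \<cdot> q) ^ 4 = norm (c * q\<^sup>2 * (c * q\<^sup>2))"
      unfolding norm_selfadjoint_square[OF h] by (metis power_mult numeral_Bit0 mult_2)
    also have "c * q\<^sup>2 * (c * q\<^sup>2) = c\<^sup>2 * q ^ 4"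
      unfolding power2_eq_square power4_eq_xxxx by (metis qc mult.assoc)
    also have "c\<^sup>2 = (1 / K) *\<^sub>R e ^ 8" using pow K by (simp add: c_def)
    also have "norm ((1 / K) *\<^sub>R e ^ 8 * q ^ 4) = norm (e ^ 8 * q ^ 4) / K" using K by simp
    also have "e ^ 8 * q ^ 4 = (e * R n) ^ 4 * (e * R m) ^ 4"
    proof -
      have "e ^ 8 * q ^ 4 = (e * e) ^ 4 * q ^ 4" by (simp add: power2_eq_square[symmetric] power_mult[symmetric])
      also have "\<dots> = (e * e * q) ^ 4"
        by (rule power_mult_commuting[symmetric]) (metis qe mult.assoc)
      also have "e * e * q = (e * R n) * (e * R m)" unfolding q_def by (metis Re mult.assoc)
      also have "\<dots> ^ 4 = (e * R n) ^ 4 * (e * R m) ^ 4"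
        by (rule power_mult_commuting) (metis Re RR mult.assoc)
      finally show ?thesis .
    qed
    also have "norm \<dots> \<le> 2 ^ 4 * 2 ^ 4"
      by (intro order_trans[OF norm_mult_ineq] mult_mono order_trans[OF norm_power_ineq] power_mono R) simp_all
    finally have b: "norm (x \<cdot> q) ^ 4 \<le> 256 / K" using K by (simp add: divide_right_mono)
    show ?thesis
    proof (cases "norm (x \<cdot> q) \<le> 1")
      case True
      thus ?thesis using K by (simp add: M_def q_def add_increasing2)
    next
      case False
      hence "norm (x \<cdot> q) ^ 1 \<le> norm (x \<cdot> q) ^ 4" by (intro power_increasing) simp_all
      thus ?thesis using b by (simp add: M_def q_def)
    qed
  qed
  have M0: "0 < M" using K by (simp add: M_def add_pos_nonneg)
  have RdR: "R n - R m = (\<epsilon> m - \<epsilon> n) *\<^sub>R (R n * R m)" for n m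
  proof -
    have "R n - R m = R n * ((e + \<epsilon> m *\<^sub>R 1) * R m) - (R n * (e + \<epsilon> n *\<^sub>R 1)) * R m" by (simp add: R)
    thus ?thesis by (simp add: algebra_simps)
  qed
  have dist: "dist (x \<cdot> R n) (x \<cdot> R m) \<le> M * dist (\<epsilon> n) (\<epsilon> m)" for n m
  proof -
    have "dist (x \<cdot> R n) (x \<cdot> R m) = \<bar>\<epsilon> m - \<epsilon> n\<bar> * norm (x \<cdot> (R n * R m))"
      by (simp add: dist_norm act_diff_right[symmetric] RdR act_scaleR_right)
    also have "\<dots> \<le> \<bar>\<epsilon> m - \<epsilon> n\<bar> * M" by (intro mult_left_mono M) simp
    finally show ?thesis by (simp add: dist_real_def abs_minus_commute mult.commute)
  qed
  have "Cauchy (\<lambda>n. x \<cdot> R n)"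
  proof (rule metric_CauchyI)
    fix r :: real assume "0 < r"
    with M0 have "0 < r / M" by simp
    then obtain N where N: "\<And>m n. m \<ge> N \<Longrightarrow> n \<ge> N \<Longrightarrow> dist (\<epsilon> m) (\<epsilon> n) < r / M"
      using metric_CauchyD[OF LIMSEQ_imp_Cauchy[OF \<epsilon>0]] by metis
    have "dist (x \<cdot> R m) (x \<cdot> R n) < r" if "m \<ge> N" "n \<ge> N" for m n
      using dist[of m n] N[OF that] M0 by (simp add: field_simps)
    thus "\<exists>N. \<forall>m\<ge>N. \<forall>n\<ge>N. dist (x \<cdot> R m) (x \<cdot> R n) < r" by blast
  qed
  then obtain y where y: "(\<lambda>n. x \<cdot> R n) \<longlonglongrightarrow> y" using Cauchy_convergent convergent_def by blast
  have "x \<cdot> R n \<cdot> e = x - \<epsilon> n *\<^sub>R (x \<cdot> R n)" for n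
  proof -
    have "R n * e = 1 - \<epsilon> n *\<^sub>R R n" using R(2)[of n] by (simp add: distrib_left eq_diff_eq)
    thus ?thesis by (simp add: act_mult[symmetric] act_diff_right act_one act_scaleR_right)
  qed
  moreover have "(\<lambda>n. x - \<epsilon> n *\<^sub>R (x \<cdot> R n)) \<longlonglongrightarrow> x - 0 *\<^sub>R y"
    by (intro tendsto_intros \<epsilon>0 y)
  moreover have "(\<lambda>n. x \<cdot> R n \<cdot> e) \<longlonglongrightarrow> y \<cdot> e"
    by (rule bounded_linear.tendsto[OF bounded_linear_act_left y])
  ultimately have "x = y \<cdot> e" using LIMSEQ_unique by fastforce
  thus thesis by (rule that)
qed

lemma hilbert_module_unitization:
  fixes act :: "'x::complex_banach \<Rightarrow> 'a::cstar_algebra \<Rightarrow> 'x" (infixl "\<cdot>" 75)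
  assumes "hilbert_module act ip"
  shows "hilbert_module (\<lambda>x u. scalar_part u *\<^sub>C x + x \<cdot> algebra_part u) (\<lambda>x y. Unitization 0 (ip x y))"
proof -
  interpret hilbert_module act ip by fact
  show ?thesis
  proof
    fix x y z :: 'x and u v :: "'a unitization" and c :: complex
    show "positive_elem (Unitization 0 (ip x x))"
    proof -
      obtain d where "ip x x = star d * d" using ip_positive[of x] by (auto simp: positive_elem_def)
      hence "Unitization 0 (ip x x) = star (Unitization 0 d) * Unitization 0 d"
        by (intro unitization_eqI) simp_all
      thus ?thesis by (auto simp: positive_elem_def)
    qed
    show "x = 0" if "Unitization 0 (ip x x) = 0"
      using that ip_definite by (simp add: zero_unitization_def)
    show "norm x = sqrt (norm (Unitization 0 (ip x x)))"
      using norm_ip[of x] operator_norm_nonneg[of "Unitization 0 (ip x x)"]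
      by (simp add: norm_unitization_def operator_norm_algebra max_def)
    show "Unitization 0 (ip x (scalar_part u *\<^sub>C y + y \<cdot> algebra_part u)) = Unitization 0 (ip x y) * u"
      by (rule unitization_eqI) (simp_all add: ip_add_right ip_scaleC_right ip_act_right)
    show "Unitization 0 (ip y x) = star (Unitization 0 (ip x y))"
      by (rule unitization_eqI) (simp_all add: ip_commute[symmetric])
    show "Unitization 0 (ip x (y + z)) = Unitization 0 (ip x y) + Unitization 0 (ip x z)"
      by (rule unitization_eqI) (simp_all add: ip_add_right)
    show "Unitization 0 (ip x (c *\<^sub>C y)) = c *\<^sub>C Unitization 0 (ip x y)"
      by (rule unitization_eqI) (simp_all add: ip_scaleC_right)
  qed (simp_all add: act_add_left act_add_right act_mult act_scaleC_left act_scaleC_right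
      scaleC_add_left scaleC_add_right scaleC_scaleC mult.commute algebra_simps)
qed

text \<open>The scaling \<open>\<kappa>\<close> makes \<open>c\<close> a contraction, so that \<open>c\<^sup>2\<close> has an eighth root \<open>e\<close> in the unitization. Its
  scalar part vanishes because that of \<open>c\<^sup>2\<close> does, so \<open>e\<close> comes from an element \<open>a\<close> of the algebra. The
  finer root \<open>f\<close> is recorded because \<open>a = f f\<^sup>2 f\<close> is the form in which \<open>a\<close> can be approximated under a
  completely positive map.\<close>

lemma factorization:
  fixes act :: "'x::complex_banach \<Rightarrow> 'a::cstar_algebra \<Rightarrow> 'x" (infixl "\<cdot>" 75)
  assumes hm: "hilbert_module act ip"
  obtains \<kappa> c f y a where "c = \<kappa> *\<^sub>R ip x x" "norm (1 - f) \<le> 1" "f ^ 32 = (Unitization 0 c)\<^sup>2"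
    "\<And>B. closed_subalgebra B \<Longrightarrow> Unitization 0 c \<in> B \<Longrightarrow> f \<in> B"
    "Unitization 0 a = f ^ 4" "x = y \<cdot> a"
proof -
  interpret hilbert_module act ip by fact
  define \<kappa> where "\<kappa> = 1 / (1 + norm (ip x x))"
  define c where "c = \<kappa> *\<^sub>R ip x x"
  have \<kappa>: "0 < \<kappa>" by (simp add: \<kappa>_def add_pos_nonneg)
  have "norm c \<le> 1" by (simp add: c_def \<kappa>_def add_pos_nonneg)
  hence c1: "norm (Unitization 0 c) \<le> 1" using norm_unitization_le_parts[of "Unitization 0 c"] by simp
  have csa: "star (Unitization 0 c) = Unitization 0 c"
    by (rule unitization_eqI) (simp_all add: c_def star_scaleR ip_commute[symmetric])
  have cip: "Unitization 0 c = \<kappa> *\<^sub>R Unitization 0 (ip x x)"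
    by (rule unitization_eqI) (simp_all add: c_def)
  obtain e where e: "star e = e" "norm (1 - e) \<le> 1" "e ^ (2 ^ 3) = (Unitization 0 c)\<^sup>2"
    "\<And>B. closed_subalgebra B \<Longrightarrow> Unitization 0 c \<in> B \<Longrightarrow> e \<in> B"
    using selfadjoint_root[OF csa c1, of 3] by blast
  obtain g where g: "star g = g" "norm (1 - g) \<le> 1" "g\<^sup>2 = e"
    "\<And>B. closed_subalgebra B \<Longrightarrow> e \<in> B \<Longrightarrow> g \<in> B"
    using selfadjoint_square_root[OF e(1,2)] by blast
  obtain f where f: "star f = f" "norm (1 - f) \<le> 1" "f\<^sup>2 = g"
    "\<And>B. closed_subalgebra B \<Longrightarrow> g \<in> B \<Longrightarrow> f \<in> B"
    using selfadjoint_square_root[OF g(1,2)] by blast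
  have fe: "f ^ 4 = e" using f(3) g(3) by (metis power_mult numeral_Bit0 mult_2 num_double power2_eq_square power4_eq_xxxx mult.assoc)
  have e8: "e ^ 8 = (Unitization 0 c)\<^sup>2" using e(3) by simp
  have com: "e * Unitization 0 (ip x x) = Unitization 0 (ip x x) * e"
    using e(4)[OF closed_subalgebra_commutant[of "Unitization 0 (ip x x)"]] by (simp add: cip)
  have "scalar_part e ^ 8 = 0" unfolding scalar_part_power[symmetric] e8 by (simp add: power2_eq_square)
  hence se: "scalar_part e = 0" by simp
  have K: "0 < \<kappa>\<^sup>2" using \<kappa> by simp
  have pow: "e ^ 8 = \<kappa>\<^sup>2 *\<^sub>R (Unitization 0 (ip x x))\<^sup>2"
    unfolding e8 cip by (simp add: power2_eq_square)
  obtain y where y: "x = scalar_part e *\<^sub>C y + y \<cdot> algebra_part e"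
    using factorization_unital[OF hilbert_module_unitization[OF hm] _ e(1,2) com pow K] act_zero_right
    by auto
  show thesis
  proof (rule that[OF c_def f(2)])
    show "f ^ 32 = (Unitization 0 c)\<^sup>2" unfolding e8[symmetric] fe[symmetric] power_mult[symmetric] by simp
    show "f \<in> B" if "closed_subalgebra B" "Unitization 0 c \<in> B" for B using e(4) f(4) g(4) that by blast
    show "Unitization 0 (algebra_part e) = f ^ 4" unfolding fe by (rule unitization_eqI) (simp_all add: se)
    show "x = y \<cdot> algebra_part e" using y se by simp
  qed
qed

section \<open>Completely positive maps\<close>

lemma op_apply_linear:
  "op_apply T (x + y) = op_apply T x + op_apply T y"
  "op_apply T (c *\<^sub>C x) = c *\<^sub>C op_apply T x"
  "op_apply T (x - y) = op_apply T x - op_apply T y"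
proof -
  have T: "bounded_linear (op_apply T)" "clinear (op_apply T)" using op_apply[of T] by auto
  show "op_apply T (x + y) = op_apply T x + op_apply T y" "op_apply T (c *\<^sub>C x) = c *\<^sub>C op_apply T x"
    using T(2) by (simp_all add: clinear_def)
  show "op_apply T (x - y) = op_apply T x - op_apply T y"
    by (rule linear_diff[OF bounded_linear.linear[OF T(1)]])
qed

lemma op_apply_arith [simp]:
  "op_apply (S + T) x = op_apply S x + op_apply T x"
  "op_apply (c *\<^sub>C S) x = c *\<^sub>C op_apply S x"
  "op_apply (U \<circ>\<^sub>L T) x = op_apply U (op_apply T x)"
  by (transfer, simp)+

lemma cinner_diff_right: "cinner x (y - z) = cinner x y - cinner x (z :: 'a::complex_hilbert)"
  using cinner_add_right[of x y "- z"] by (simp add: cinner_minus_right)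

lemma cinner_diff_left: "cinner (x - y) z = cinner x z - cinner y (z :: 'a::complex_hilbert)"
  using cinner_add_left[of x "- y" z] by (simp add: cinner_minus_left)

lemma op_comp_assoc: "S \<circ>\<^sub>L T \<circ>\<^sub>L U = S \<circ>\<^sub>L (T \<circ>\<^sub>L U)"
  by (rule op_eqI) simp

lemma op_comp_linear:
  "(S + T) \<circ>\<^sub>L U = S \<circ>\<^sub>L U + T \<circ>\<^sub>L U" "S \<circ>\<^sub>L (T' + U') = S \<circ>\<^sub>L T' + S \<circ>\<^sub>L U'"
  "(c *\<^sub>C S) \<circ>\<^sub>L U = c *\<^sub>C (S \<circ>\<^sub>L U)" "S \<circ>\<^sub>L (c *\<^sub>C U) = c *\<^sub>C (S \<circ>\<^sub>L U)"
  by (rule op_eqI; simp add: op_apply_linear)+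

lemma op_adj_adj: "op_adj (op_adj T) = T"
  by (rule op_adj_unique) (metis cinner_commute cinner_op_adj)

lemma op_adj_comp: "op_adj (S \<circ>\<^sub>L T) = op_adj T \<circ>\<^sub>L op_adj S"
  by (rule op_adj_unique) (simp add: cinner_op_adj)

lemma completely_positive_square:
  assumes "completely_positive \<phi>"
  shows "cinner \<xi> (op_apply (\<phi> (star a * a)) \<xi>) \<in> \<real>\<^sub>\<ge>\<^sub>0"
proof -
  have "positive_matrix 1 (\<lambda>i j. star a * a)"
    unfolding positive_matrix_def by (intro exI[of _ "\<lambda>k i. a"]) simp
  hence "positive_op_matrix 1 (\<lambda>i j. \<phi> (star a * a))"
    using assms by (simp add: completely_positive_def)
  thus ?thesis unfolding positive_op_matrix_def by (auto dest: spec[of _ "\<lambda>_. \<xi>"])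
qed

text \<open>The matrix with entries \<open>v\<^sub>i\<^sup>* v\<^sub>j\<close>, where \<open>v = (a, b)\<close>, is positive; its form is evaluated at \<open>(\<xi>, \<eta>)\<close>.\<close>

lemma completely_positive_pair:
  assumes "completely_positive \<phi>"
  shows "cinner \<xi> (op_apply (\<phi> (star a * a)) \<xi>) + cinner \<xi> (op_apply (\<phi> (star a * b)) \<eta>)
    + cinner \<eta> (op_apply (\<phi> (star b * a)) \<xi>) + cinner \<eta> (op_apply (\<phi> (star b * b)) \<eta>) \<in> \<real>\<^sub>\<ge>\<^sub>0"
proof -
  define v where "v i = (if i = 0 then a else b)" for i :: nat
  have "positive_matrix 2 (\<lambda>i j. star (v i) * v j)"
    unfolding positive_matrix_def
    by (intro exI[of _ "\<lambda>k i. if k = 0 then v i else 0"]) (simp add: numeral_2_eq_2)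
  hence "positive_op_matrix 2 (\<lambda>i j. \<phi> (star (v i) * v j))"
    using assms by (simp add: completely_positive_def)
  from this[unfolded positive_op_matrix_def, rule_format, of "\<lambda>i. if i = 0 then \<xi> else \<eta>"]
  show ?thesis by (simp add: numeral_2_eq_2 v_def cinner_add_right add.assoc)
qed

text \<open>The form of the pair \<open>a\<close>, \<open>b\<close> and its diagonal terms are real, so the two off-diagonal terms have
  a real sum. Replacing \<open>\<eta>\<close> by \<open>\<i> \<eta>\<close> shows that they are conjugate to each other.\<close>

lemma completely_positive_star_mult:
  assumes cp: "completely_positive \<phi>"
  shows "\<phi> (star b * a) = op_adj (\<phi> (star a * b))"
proof (rule op_adj_unique[symmetric])
  fix \<eta> \<xi>
  define p where "p = cinner \<xi> (op_apply (\<phi> (star a * b)) \<eta>)"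
  define q where "q = cinner \<eta> (op_apply (\<phi> (star b * a)) \<xi>)"
  note sq = completely_positive_square[OF cp, unfolded complex_nonneg_Reals_iff]
  have "Im (p + q) = 0"
    using completely_positive_pair[OF cp, of \<xi> a b \<eta>] sq[of \<xi> a] sq[of \<eta> b]
    by (simp add: complex_nonneg_Reals_iff p_def q_def)
  moreover have "Im (\<i> * p - \<i> * q) = 0"
    using completely_positive_pair[OF cp, of \<xi> a b "\<i> *\<^sub>C \<eta>"] sq[of \<xi> a] sq[of "\<i> *\<^sub>C \<eta>" b]
    by (simp add: complex_nonneg_Reals_iff p_def q_def op_apply_linear cinner_scaleC_right cinner_scaleC_left)
  ultimately have "q = cnj p" by (simp add: complex_eq_iff)
  thus "cinner (op_apply (\<phi> (star b * a)) \<xi>) \<eta> = cinner \<xi> (op_apply (\<phi> (star a * b)) \<eta>)"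
    unfolding p_def q_def by (metis cinner_commute complex_cnj_cnj)
qed

text \<open>Every element of a C*-algebra is a product of two elements, by factorization in the algebra as a
  module over itself.\<close>

lemma completely_positive_star:
  fixes \<phi> :: "'a::cstar_algebra \<Rightarrow> ('h::complex_hilbert, 'h) bounded_op"
  assumes cp: "completely_positive \<phi>"
  shows "\<phi> (star b) = op_adj (\<phi> b)"
proof -
  have "hilbert_module (\<lambda>x y :: 'a. x * y) (\<lambda>x y. star x * y)"
  proof
    fix x :: 'a
    show "x = 0" if "star x * x = 0" using cstar_norm[of x] that by simp
    show "norm x = sqrt (norm (star x * x))" by (simp add: cstar_norm)
  qed (auto simp: algebra_simps scaleC_mult_left scaleC_mult_right star_mult star_star positive_elem_def)
  then obtain y a where "b = y * a" using factorization[of "\<lambda>x y :: 'a. x * y" "\<lambda>x y. star x * y" b] by metis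
  thus ?thesis using completely_positive_star_mult[OF cp, of a "star y"] by (simp add: star_mult star_star)
qed

lemma left_mult_assoc: "left_mult q r * b = left_mult q (r * b)"
  by (simp add: left_mult_def algebra_simps scaleC_mult_left)

text \<open>With \<open>s = \<surd>(1 - q\<^sup>* q)\<close> the difference \<open>r\<^sup>* r - (q r)\<^sup>* (q r)\<close> equals \<open>(s r)\<^sup>* (s r)\<close>, and \<open>s r\<close> belongs to the
  algebra although \<open>s\<close> need not.\<close>

lemma completely_positive_left_mult_le:
  fixes \<phi> :: "'a::cstar_algebra \<Rightarrow> ('h::complex_hilbert, 'h) bounded_op"
  assumes cp: "completely_positive \<phi>" and lin: "clinear \<phi>" and q: "norm q \<le> 1"
  shows "Re (cinner \<eta> (op_apply (\<phi> (star (left_mult q r) * left_mult q r)) \<eta>))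
    \<le> Re (cinner \<eta> (op_apply (\<phi> (star r * r)) \<eta>))"
proof -
  define s where "s = sqrt_one_minus (star q * q)"
  have n: "norm (star q * q) \<le> 1" using q by (simp add: cstar_norm power_le_one)
  have s: "star s = s" unfolding s_def by (rule star_sqrt_one_minus[OF n]) (simp add: star_mult star_star)
  have "star (left_mult s r) * left_mult s r = star r * left_mult (s * s) r"
    by (simp add: left_mult_star s left_mult_mult)
  also have "s * s = 1 - star q * q" unfolding s_def by (rule sqrt_one_minus_square[OF n])
  also have "left_mult (1 - star q * q) r = r - left_mult (star q) (left_mult q r)"
  proof -
    have "left_mult (1 - star q * q) r + left_mult (star q * q) r = left_mult 1 r"
      by (simp add: left_mult_add[symmetric])
    thus ?thesis by (simp add: left_mult_mult left_mult_def[of 1] eq_diff_eq)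
  qed
  also have "star r * (r - left_mult (star q) (left_mult q r)) + star (left_mult q r) * left_mult q r = star r * r"
    by (simp add: left_mult_star algebra_simps)
  finally have "star (left_mult s r) * left_mult s r + star (left_mult q r) * left_mult q r = star r * r" .
  hence "\<phi> (star r * r) = \<phi> (star (left_mult s r) * left_mult s r) + \<phi> (star (left_mult q r) * left_mult q r)"
    using lin by (metis clinear_def)
  thus ?thesis using completely_positive_square[OF cp, of \<eta> "left_mult s r"]
    by (simp add: cinner_add_right complex_nonneg_Reals_iff)
qed

text \<open>For a contraction \<open>q\<close>, positivity of the form of the pair \<open>l\<^sup>*\<close>, \<open>q r\<close> bounds the off-diagonal term
  \<open>\<langle>\<xi>, \<phi>(l q r) \<eta>\<rangle>\<close> by the diagonal ones, the second of which is at most \<open>\<langle>\<eta>, \<phi>(r\<^sup>* r) \<eta>\<rangle>\<close> by the previous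
  lemma.\<close>

lemma bounded_linear_completely_positive_middle:
  fixes \<phi> :: "'a::cstar_algebra \<Rightarrow> ('h::complex_hilbert, 'h) bounded_op"
  assumes cp: "completely_positive \<phi>" and lin: "clinear \<phi>"
  shows "bounded_linear (\<lambda>q. cinner \<xi> (op_apply (\<phi> (l * left_mult q r)) \<eta>))"
proof -
  define G where "G q = cinner \<xi> (op_apply (\<phi> (l * left_mult q r)) \<eta>)" for q
  define A where "A = Re (cinner \<xi> (op_apply (\<phi> (l * star l)) \<xi>))"
  define B where "B = Re (cinner \<eta> (op_apply (\<phi> (star r * r)) \<eta>))"
  have add: "G (p + q) = G p + G q" for p q
    using lin by (simp add: G_def left_mult_add distrib_left clinear_def cinner_add_right)
  have scC: "G (c *\<^sub>C q) = c * G q" for c q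
    using lin by (simp add: G_def left_mult_scaleC scaleC_mult_right clinear_def cinner_scaleC_right)
  have re: "2 * Re (G q) \<le> A + B" if q: "norm q \<le> 1" for q
  proof -
    \<comment> \<open>The sign turns the lower bound given by positivity into an upper bound for \<open>Re (G q)\<close>.\<close>
    define m where "m = - left_mult q r"
    have m: "left_mult (- q) r = m"
      by (simp add: m_def left_mult_def scaleC_minus_right)
        (metis add_eq_0_iff scaleC_add_left scaleC_zero_left right_minus)
    have G: "cinner \<xi> (op_apply (\<phi> (l * m)) \<eta>) = - G q"
      using add[of q "- q"] scC[of 0 0] by (simp add: G_def[of "- q"] m eq_neg_iff_add_eq_0 add.commute)
    have "\<phi> (star m * star l) = op_adj (\<phi> (l * m))"
      using completely_positive_star_mult[OF cp, of m "star l"] by (simp add: star_star)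
    hence "cinner \<eta> (op_apply (\<phi> (star m * star l)) \<xi>) = cnj (cinner \<xi> (op_apply (\<phi> (l * m)) \<eta>))"
      by (metis cinner_commute cinner_op_adj)
    hence "0 \<le> A - 2 * Re (G q) + Re (cinner \<eta> (op_apply (\<phi> (star m * m)) \<eta>))"
      using completely_positive_pair[OF cp, of \<xi> "star l" m \<eta>]
      by (simp add: complex_nonneg_Reals_iff A_def star_star G)
    also have "Re (cinner \<eta> (op_apply (\<phi> (star m * m)) \<eta>)) \<le> B"
      using completely_positive_left_mult_le[OF cp lin, of "- q" \<eta> r] q by (simp add: m B_def)
    finally show ?thesis by simp
  qed
  have bound: "cmod (G q) \<le> A + B" if q: "norm q \<le> 1" for q
  proof -
    \<comment> \<open>Rotate \<open>q\<close> by a phase that makes \<open>G\<close> real and nonnegative.\<close>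
    define c where "c = cnj (sgn (G q))"
    have "c * G q = complex_of_real (cmod (G q))"
      by (cases "G q = 0")
        (simp_all add: c_def sgn_eq complex_norm_square[symmetric] mult.commute[of "cnj _"] power2_eq_square)
    moreover have "norm (c *\<^sub>C q) \<le> 1"
      using q by (simp add: c_def norm_scaleC norm_sgn)
    ultimately have "2 * cmod (G q) \<le> A + B" using re[of "c *\<^sub>C q"] by (simp add: scC)
    thus ?thesis using norm_ge_zero[of "G q"] by linarith
  qed
  have "bounded_linear G"
  proof (rule bounded_linear_intro[where K = "A + B"])
    show scR: "G (r *\<^sub>R q) = r *\<^sub>R G q" for r q
      using scC[of "complex_of_real r" q] by (simp add: scaleC_of_real scaleR_conv_of_real)
    show "norm (G q) \<le> norm q * (A + B)" for q
    proof (cases "q = 0")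
      case True
      thus ?thesis using scC[of 0 q] by simp
    next
      case False
      have "q = norm q *\<^sub>R sgn q" using False by (simp add: sgn_div_norm)
      hence "norm (G q) = norm q * norm (G (sgn q))" by (metis scR norm_scaleR abs_norm_cancel)
      thus ?thesis using bound[of "sgn q"] False by (simp add: norm_sgn mult_left_mono)
    qed
  qed (rule add)
  thus ?thesis by (simp add: G_def[abs_def])
qed

section \<open>The ternary domain of a completely positive map\<close>

text \<open>For a map that preserves adjoints this is \<open>T\<^sub>\<phi>\<close>; the formulation without adjoints makes it visible that
  the set is closed under products and under limits in a middle factor.\<close>

definition ternary_subalgebra :: "('a::cstar_algebra \<Rightarrow> ('h::complex_hilbert, 'h) bounded_op) \<Rightarrow> 'a set" where
  "ternary_subalgebra \<phi> = {a. \<forall>b c. \<phi> (a * b) = \<phi> a \<circ>\<^sub>L \<phi> b \<and> \<phi> (b * a) = \<phi> b \<circ>\<^sub>L \<phi> a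
    \<and> \<phi> (b * a * c) = \<phi> b \<circ>\<^sub>L \<phi> a \<circ>\<^sub>L \<phi> c}"

lemma ternary_domain_alg_eq:
  assumes cp: "completely_positive \<phi>"
  shows "ternary_domain_alg \<phi> = ternary_subalgebra \<phi>"
proof -
  note st = completely_positive_star[OF cp]
  have "(\<forall>b c. \<phi> (b * star a * c) = \<phi> b \<circ>\<^sub>L op_adj (\<phi> a) \<circ>\<^sub>L \<phi> c)
      \<longleftrightarrow> (\<forall>b c. \<phi> (b * a * c) = \<phi> b \<circ>\<^sub>L \<phi> a \<circ>\<^sub>L \<phi> c)" for a
  proof -
    have adj: "\<phi> (b * star a * c) = \<phi> b \<circ>\<^sub>L op_adj (\<phi> a) \<circ>\<^sub>L \<phi> c
      \<longleftrightarrow> \<phi> (star c * a * star b) = \<phi> (star c) \<circ>\<^sub>L \<phi> a \<circ>\<^sub>L \<phi> (star b)" for b c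
    proof -
      have "star (b * star a * c) = star c * a * star b" by (simp add: star_mult star_star mult.assoc)
      hence "\<phi> (star c * a * star b) = op_adj (\<phi> (b * star a * c))" by (metis st)
      moreover have "\<phi> (star c) \<circ>\<^sub>L \<phi> a \<circ>\<^sub>L \<phi> (star b) = op_adj (\<phi> b \<circ>\<^sub>L op_adj (\<phi> a) \<circ>\<^sub>L \<phi> c)"
        by (simp add: st op_adj_comp op_adj_adj op_comp_assoc)
      ultimately show ?thesis by (metis op_adj_adj)
    qed
    show ?thesis unfolding adj by (metis star_star)
  qed
  thus ?thesis by (auto simp: ternary_domain_alg_def multiplicative_domain_def ternary_subalgebra_def)
qed

lemma ternary_subalgebra_add:
  assumes "clinear \<phi>" "a \<in> ternary_subalgebra \<phi>" "b \<in> ternary_subalgebra \<phi>"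
  shows "a + b \<in> ternary_subalgebra \<phi>"
  using assms by (simp add: ternary_subalgebra_def clinear_def distrib_left distrib_right op_comp_linear)

lemma ternary_subalgebra_scaleR:
  assumes "clinear \<phi>" "a \<in> ternary_subalgebra \<phi>"
  shows "r *\<^sub>R a \<in> ternary_subalgebra \<phi>"
  using assms unfolding scaleC_of_real[symmetric]
  by (simp add: ternary_subalgebra_def clinear_def scaleC_mult_left scaleC_mult_right op_comp_linear)

lemma ternary_subalgebra_mult:
  assumes "a \<in> ternary_subalgebra \<phi>" "b \<in> ternary_subalgebra \<phi>"
  shows "a * b \<in> ternary_subalgebra \<phi>"
proof -
  have a: "\<phi> (a * x) = \<phi> a \<circ>\<^sub>L \<phi> x" "\<phi> (x * (a * y)) = \<phi> x \<circ>\<^sub>L \<phi> a \<circ>\<^sub>L \<phi> y" for x y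
    using assms(1) by (auto simp: ternary_subalgebra_def mult.assoc)
  have b: "\<phi> (b * x) = \<phi> b \<circ>\<^sub>L \<phi> x" for x using assms(2) by (auto simp: ternary_subalgebra_def)
  show ?thesis unfolding ternary_subalgebra_def by (simp add: mult.assoc a b op_comp_assoc)
qed

lemma op_eq_cinnerI: "(\<And>\<xi> \<eta>. cinner \<xi> (op_apply S \<eta>) = cinner \<xi> (op_apply T \<eta>)) \<Longrightarrow> S = T"
  by (rule op_eqI, rule cinner_ext) (metis cinner_commute)

text \<open>Each condition that defines the set multiplies \<open>l q r\<close> from outside, so it can be absorbed into \<open>l\<close>,
  \<open>r\<close> and the two vectors, and survives the limit in \<open>q\<close>.\<close>

lemma ternary_subalgebra_middle_limit:
  fixes \<phi> :: "'a::cstar_algebra \<Rightarrow> ('h::complex_hilbert, 'h) bounded_op"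
  assumes cp: "completely_positive \<phi>" and lin: "clinear \<phi>"
    and q: "q \<longlonglongrightarrow> q'" and T: "\<And>n. l * left_mult (q n) r \<in> ternary_subalgebra \<phi>"
  shows "l * left_mult q' r \<in> ternary_subalgebra \<phi>"
proof -
  have lim: "(\<lambda>n. cinner \<xi> (op_apply (\<phi> (l * left_mult (q n) r)) \<eta>))
      \<longlonglongrightarrow> cinner \<xi> (op_apply (\<phi> (l * left_mult q' r)) \<eta>)" for l r \<xi> \<eta>
    by (rule bounded_linear.tendsto[OF bounded_linear_completely_positive_middle[OF cp lin] q])
  have T1: "\<phi> (l * left_mult (q n) (r * b)) = \<phi> (l * left_mult (q n) r) \<circ>\<^sub>L \<phi> b"
    "\<phi> (b * l * left_mult (q n) r) = \<phi> b \<circ>\<^sub>L \<phi> (l * left_mult (q n) r)"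
    "\<phi> (b * l * left_mult (q n) (r * c)) = \<phi> b \<circ>\<^sub>L \<phi> (l * left_mult (q n) r) \<circ>\<^sub>L \<phi> c" for n b c
    using T[of n] by (simp_all add: ternary_subalgebra_def left_mult_assoc[symmetric] mult.assoc)
  have "\<phi> (l * left_mult q' (r * b)) = \<phi> (l * left_mult q' r) \<circ>\<^sub>L \<phi> b" for b
  proof (rule op_eq_cinnerI)
    fix \<xi> \<eta>
    show "cinner \<xi> (op_apply (\<phi> (l * left_mult q' (r * b))) \<eta>)
        = cinner \<xi> (op_apply (\<phi> (l * left_mult q' r) \<circ>\<^sub>L \<phi> b) \<eta>)"
      using LIMSEQ_unique[OF lim[of \<xi> l "r * b" \<eta>, unfolded T1 op_apply_arith] lim] by simp
  qed
  moreover have "\<phi> (b * l * left_mult q' r) = \<phi> b \<circ>\<^sub>L \<phi> (l * left_mult q' r)" for b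
  proof (rule op_eq_cinnerI)
    fix \<xi> \<eta>
    show "cinner \<xi> (op_apply (\<phi> (b * l * left_mult q' r)) \<eta>)
        = cinner \<xi> (op_apply (\<phi> b \<circ>\<^sub>L \<phi> (l * left_mult q' r)) \<eta>)"
      using LIMSEQ_unique[OF lim[of \<xi> "b * l" r \<eta>, unfolded T1 op_apply_arith]
          lim[of "op_apply (op_adj (\<phi> b)) \<xi>" l r \<eta>, unfolded cinner_op_adj[of "\<phi> b"]]]
      by simp
  qed
  moreover have "\<phi> (b * l * left_mult q' (r * c)) = \<phi> b \<circ>\<^sub>L \<phi> (l * left_mult q' r) \<circ>\<^sub>L \<phi> c" for b c
  proof (rule op_eq_cinnerI)
    fix \<xi> \<eta>
    show "cinner \<xi> (op_apply (\<phi> (b * l * left_mult q' (r * c))) \<eta>)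
        = cinner \<xi> (op_apply (\<phi> b \<circ>\<^sub>L \<phi> (l * left_mult q' r) \<circ>\<^sub>L \<phi> c) \<eta>)"
      using LIMSEQ_unique[OF lim[of \<xi> "b * l" "r * c" \<eta>, unfolded T1 op_apply_arith]
          lim[of "op_apply (op_adj (\<phi> b)) \<xi>" l r "op_apply (\<phi> c) \<eta>", unfolded cinner_op_adj[of "\<phi> b"]]]
      by simp
  qed
  ultimately show ?thesis by (simp add: ternary_subalgebra_def left_mult_assoc mult.assoc)
qed

text \<open>The multipliers that map \<open>T\<^sub>\<phi>\<close> into itself form a unital algebra \<open>P\<close> containing \<open>c\<close>; hence every limit \<open>q\<close>
  of polynomials in \<open>c\<close> lies in the closure of \<open>P\<close>. Invariance of \<open>T\<^sub>\<phi>\<close> does not pass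
  to the limit directly, but with \<open>q\<close> between two factors \<open>c\<close> the limit lemma applies.\<close>

lemma ternary_subalgebra_left_mult:
  fixes \<phi> :: "'a::cstar_algebra \<Rightarrow> ('h::complex_hilbert, 'h) bounded_op"
  assumes cp: "completely_positive \<phi>" and lin: "clinear \<phi>" and c: "c \<in> ternary_subalgebra \<phi>"
  defines "P \<equiv> {q. \<forall>d \<in> ternary_subalgebra \<phi>. left_mult q d \<in> ternary_subalgebra \<phi>}"
  shows "closed_subalgebra (closure P)" "Unitization 0 c \<in> closure P"
    "q \<in> closure P \<Longrightarrow> c * left_mult q c \<in> ternary_subalgebra \<phi>"
proof -
  show "closed_subalgebra (closure P)"
  proof (rule closed_subalgebra_closure)
    show "1 \<in> P" by (simp add: P_def left_mult_def)
    show "x + y \<in> P" if "x \<in> P" "y \<in> P" for x y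
      using that by (simp add: P_def left_mult_add ternary_subalgebra_add[OF lin])
    show "x * y \<in> P" if "x \<in> P" "y \<in> P" for x y
      using that by (simp add: P_def left_mult_mult)
    show "r *\<^sub>R x \<in> P" if "x \<in> P" for r x
      using that unfolding P_def
      by (simp add: left_mult_scaleC scaleC_of_real[symmetric])
        (simp add: scaleC_of_real ternary_subalgebra_scaleR[OF lin])
  qed
  have "Unitization 0 c \<in> P" using c by (simp add: P_def left_mult_def ternary_subalgebra_mult)
  thus "Unitization 0 c \<in> closure P" using closure_subset by blast
  assume "q \<in> closure P"
  then obtain p where p: "\<And>n. p n \<in> P" "p \<longlonglongrightarrow> q" unfolding closure_sequential by metis
  have "c * left_mult (p n) c \<in> ternary_subalgebra \<phi>" for n
    using p(1)[of n] c by (simp add: P_def ternary_subalgebra_mult)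
  thus "c * left_mult q c \<in> ternary_subalgebra \<phi>"
    by (rule ternary_subalgebra_middle_limit[OF cp lin p(2)])
qed

text \<open>Put \<open>p = f (f + \<epsilon>)\<^sup>-\<^sup>1\<close>. As \<open>f - f p = \<epsilon> p\<close>, the elements \<open>f p^k\<close> tend to \<open>f\<close> as \<open>\<epsilon> \<rightarrow> 0\<close> for every
  fixed \<open>k\<close>, so \<open>f (f\<^sup>2 p^28) f\<close> has the form required by the limit lemma, with middle factor tending to
  \<open>f\<^sup>2\<close>. The exponent 28 is chosen such that \<open>f\<^sup>2 p^28\<close> together with the two outer factors contains
  \<open>f^32 = c\<^sup>2\<close>: the product equals \<open>c (f + \<epsilon>)^(-28) c\<close>, which is in \<open>T\<^sub>\<phi>\<close> by the previous lemma.\<close>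

lemma ternary_subalgebra_root:
  fixes \<phi> :: "'a::cstar_algebra \<Rightarrow> ('h::complex_hilbert, 'h) bounded_op"
  assumes cp: "completely_positive \<phi>" and lin: "clinear \<phi>" and c: "c \<in> ternary_subalgebra \<phi>"
    and f: "norm (1 - f) \<le> 1" "f ^ 32 = (Unitization 0 c)\<^sup>2"
    and gen: "\<And>B. closed_subalgebra B \<Longrightarrow> Unitization 0 c \<in> B \<Longrightarrow> f \<in> B"
    and a: "Unitization 0 a = f ^ 4"
  shows "a \<in> ternary_subalgebra \<phi>"
proof -
  note P = ternary_subalgebra_left_mult[OF cp lin c]
  define \<epsilon> where "\<epsilon> n = 1 / real (Suc n)" for n
  have \<epsilon>: "0 < \<epsilon> n" for n by (simp add: \<epsilon>_def)
  have \<epsilon>0: "\<epsilon> \<longlonglongrightarrow> 0" unfolding \<epsilon>_def by (rule LIMSEQ_Suc[OF lim_1_over_n])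
  have "\<exists>R. \<forall>n. (f + \<epsilon> n *\<^sub>R 1) * R n = 1 \<and> norm (f * R n) \<le> 2
      \<and> (\<forall>B. closed_subalgebra B \<longrightarrow> f \<in> B \<longrightarrow> R n \<in> B)"
    by (rule choice) (use resolvent[OF f(1) \<epsilon>] in metis)
  then obtain R where R: "\<And>n. (f + \<epsilon> n *\<^sub>R 1) * R n = 1" "\<And>n. norm (f * R n) \<le> 2"
    "\<And>n B. closed_subalgebra B \<Longrightarrow> f \<in> B \<Longrightarrow> R n \<in> B" by metis
  have Rcom: "R n * z = z * R n" if "f * z = z * f" for n z
    using R(3)[OF closed_subalgebra_commutant[of z], of n] that by simp
  have Rf: "R n * f = f * R n" for n by (rule Rcom) simp
  have "f * Unitization 0 c = Unitization 0 c * f"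
    using gen[OF closed_subalgebra_commutant[of "Unitization 0 c"]] by simp
  hence Rc: "R n * Unitization 0 c = Unitization 0 c * R n" for n by (rule Rcom)
  have "scalar_part f ^ 32 = 0" unfolding scalar_part_power[symmetric] f by (simp add: power2_eq_square)
  hence sf: "scalar_part f = 0" by simp
  define g where "g = algebra_part f"
  have fg: "f = Unitization 0 g" by (rule unitization_eqI) (simp_all add: g_def sf)
  define p where "p n = f * R n" for n
  have p2: "norm (p n) \<le> 2" for n unfolding p_def by (rule R)
  have fp: "f - f * p n = \<epsilon> n *\<^sub>R p n" for n
  proof -
    have "p n = 1 - \<epsilon> n *\<^sub>R R n" using R(1)[of n] by (simp add: p_def distrib_right eq_diff_eq)
    hence "f * p n = f - \<epsilon> n *\<^sub>R (f * R n)" by (simp add: right_diff_distrib)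
    thus ?thesis by (simp add: p_def)
  qed
  have lim: "(\<lambda>n. f * p n ^ k) \<longlonglongrightarrow> f" for k
  proof (induction k)
    case (Suc k)
    have "(\<lambda>n. (f - f * p n) * p n ^ k) \<longlonglongrightarrow> 0"
    proof (rule Lim_null_comparison)
      show "(\<lambda>n. \<epsilon> n * 2 ^ Suc k) \<longlonglongrightarrow> 0" using tendsto_mult_left_zero[OF \<epsilon>0] by simp
      have "norm ((f - f * p n) * p n ^ k) \<le> \<epsilon> n * 2 ^ Suc k" for n
      proof -
        have "norm ((f - f * p n) * p n ^ k) = \<epsilon> n * norm (p n ^ Suc k)" using \<epsilon>[of n] by (simp add: fp)
        also have "norm (p n ^ Suc k) \<le> 2 ^ Suc k"
          using order_trans[OF norm_power_ineq power_mono[OF p2 norm_ge_zero]] .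
        finally show ?thesis using \<epsilon>[of n] by simp
      qed
      thus "\<forall>\<^sub>F n in sequentially. norm ((f - f * p n) * p n ^ k) \<le> \<epsilon> n * 2 ^ Suc k" by simp
    qed
    from tendsto_diff[OF Suc this] show ?case by (simp add: left_diff_distrib mult.assoc)
  qed simp
  have lim2: "(\<lambda>n. f * (f * p n ^ 28)) \<longlonglongrightarrow> f * f" by (intro tendsto_mult tendsto_const lim)
  have emb: "Unitization 0 (l * left_mult q r) = Unitization 0 l * q * Unitization 0 r" for l q r
    by (rule unitization_eqI) (simp_all add: left_mult_def distrib_left distrib_right mult.assoc scaleC_mult_left scaleC_mult_right)
  have "g * left_mult (f * (f * p n ^ 28)) g \<in> ternary_subalgebra \<phi>" for n
  proof -
    have pf: "p n * f = f * p n" unfolding p_def by (metis Rf mult.assoc)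
    have "f * (f * (f * p n ^ 28)) * f = f * f * f * (p n ^ 28 * f)" by (simp only: mult.assoc)
    also have "\<dots> = f * f * f * (f * p n ^ 28)" by (simp only: power_commuting_commutes[OF pf])
    also have "\<dots> = f * f * f * (f * (f ^ 28 * R n ^ 28))"
      unfolding p_def by (simp only: power_mult_commuting[OF Rf[symmetric]])
    also have "\<dots> = f ^ 32 * R n ^ 28"
      by (simp add: mult.assoc[symmetric] power4_eq_xxxx[symmetric] power_add[symmetric])
    also have "\<dots> = Unitization 0 c * (Unitization 0 c * R n ^ 28)"
      by (simp only: f(2) power2_eq_square mult.assoc)
    also have "\<dots> = Unitization 0 c * R n ^ 28 * Unitization 0 c"
      by (simp only: power_commuting_commutes[OF Rc] mult.assoc)
    finally have "Unitization 0 (g * left_mult (f * (f * p n ^ 28)) g) = Unitization 0 (c * left_mult (R n ^ 28) c)"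
      unfolding emb fg[symmetric] by (simp only: mult.assoc)
    hence "g * left_mult (f * (f * p n ^ 28)) g = c * left_mult (R n ^ 28) c" by simp
    thus ?thesis by (simp add: P(3)[OF closed_subalgebra_power[OF P(1) R(3)[OF P(1) gen[OF P(1,2)]]]])
  qed
  hence "g * left_mult (f * f) g \<in> ternary_subalgebra \<phi>"
    by (rule ternary_subalgebra_middle_limit[OF cp lin lim2])
  moreover have "Unitization 0 (g * left_mult (f * f) g) = Unitization 0 a"
    unfolding emb a fg[symmetric] by (simp add: power4_eq_xxxx mult.assoc)
  ultimately show ?thesis by simp
qed

section \<open>Maps on Hilbert modules\<close>

text \<open>Both hypotheses say that \<open>\<Phi>(y) - \<Phi>(x) S\<close> has range orthogonal to a range: the first to that of \<open>\<Phi>(y)\<close>,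
  the second to that of \<open>\<Phi>(x)\<close>. Its range is then orthogonal to itself.\<close>

lemma phi_map_eqI:
  assumes \<Phi>: "phi_map ip \<phi> \<Phi>"
    and 1: "\<phi> (ip y y) = \<phi> (ip y x) \<circ>\<^sub>L S" and 2: "\<phi> (ip x y) = \<phi> (ip x x) \<circ>\<^sub>L S"
  shows "\<Phi> y = \<Phi> x \<circ>\<^sub>L S"
proof (rule op_eqI)
  fix h
  have ip: "cinner (op_apply (\<Phi> u) h) (op_apply (\<Phi> v) k) = cinner h (op_apply (\<phi> (ip u v)) k)" for u v h k
    using \<Phi> by (metis phi_map_def op_apply_arith(3) cinner_op_adj cinner_commute)
  define d where "d = op_apply (\<Phi> y) h - op_apply (\<Phi> x) (op_apply S h)"
  have "cinner (op_apply (\<Phi> y) h) d = 0" by (simp add: d_def cinner_diff_right ip 1)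
  moreover have "cinner (op_apply (\<Phi> x) (op_apply S h)) d = 0" by (simp add: d_def cinner_diff_right ip 2)
  ultimately have "cinner d d = 0" by (subst d_def) (simp add: cinner_diff_left)
  hence "d = 0" by (simp add: cinner_self)
  thus "op_apply (\<Phi> y) h = op_apply (\<Phi> x \<circ>\<^sub>L S) h" by (simp add: d_def)
qed

text \<open>Multiplying \<open>\<langle>x, x\<rangle>\<close> by \<open>b\<close> on the left and \<open>c\<close> on the right gives \<open>\<langle>x b\<^sup>*, x c\<rangle>\<close>, whose image is
  \<open>\<Phi>(x b\<^sup>*)\<^sup>* \<Phi>(x c)\<close>; here \<open>b\<close> returns through \<open>\<phi>(b\<^sup>*)\<^sup>* = \<phi>(b)\<close>.\<close>

lemma ternary_domain_ip:
  assumes hm: "hilbert_module act ip" and cp: "completely_positive \<phi>" and \<Phi>: "phi_map ip \<phi> \<Phi>"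
    and x: "x \<in> ternary_domain act \<phi> \<Phi>"
  shows "ip x x \<in> ternary_subalgebra \<phi>"
proof -
  interpret hilbert_module act ip by fact
  have \<Phi>': "\<phi> (ip u v) = op_adj (\<Phi> u) \<circ>\<^sub>L \<Phi> v" for u v using \<Phi> by (simp add: phi_map_def)
  have x': "\<Phi> (act x b) = \<Phi> x \<circ>\<^sub>L \<phi> b" for b using x by (simp add: ternary_domain_def)
  have l: "b * ip x y = ip (act x (star b)) y" for b y by (simp add: ip_act_left star_star)
  have st: "op_adj (\<phi> (star b)) = \<phi> b" for b by (metis completely_positive_star[OF cp] star_star)
  show ?thesis
    unfolding ternary_subalgebra_def mem_Collect_eq ip_act_right[symmetric] l \<Phi>' x' op_adj_comp st op_comp_assoc
    by (simp add: mult.assoc ip_act_right[symmetric])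
qed

theorem proposition3p12:
  fixes act :: "'x::complex_banach \<Rightarrow> 'a::cstar_algebra \<Rightarrow> 'x" (infixl "\<cdot>" 75)
    and ip :: "'x \<Rightarrow> 'x \<Rightarrow> 'a"
    and \<phi> :: "'a \<Rightarrow> ('h::complex_hilbert, 'h) bounded_op"
    and \<Phi> :: "'x \<Rightarrow> ('h, 'k::complex_hilbert) bounded_op"
  assumes "hilbert_module act ip"
    and "clinear \<phi>"
    and "completely_positive \<phi>"
    and "phi_map ip \<phi> \<Phi>"
  shows "{x \<cdot> a | x a. a \<in> ternary_domain_alg \<phi>} = ternary_domain act \<phi> \<Phi>
    \<and> (\<forall>a \<in> multiplicative_domain \<phi>. \<forall>x. \<Phi> (x \<cdot> a) = \<Phi> x \<circ>\<^sub>L \<phi> a)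
    \<and> (\<forall>a \<in> ternary_domain_alg \<phi>. \<forall>x b. \<Phi> (x \<cdot> a \<cdot> b) = \<Phi> x \<circ>\<^sub>L \<phi> a \<circ>\<^sub>L \<phi> b)"
proof -
  interpret hilbert_module act ip by fact
  note lin = assms(2) and cp = assms(3) and \<Phi> = assms(4)
  have mult: "\<Phi> (x \<cdot> a) = \<Phi> x \<circ>\<^sub>L \<phi> a" if "a \<in> multiplicative_domain \<phi>" for x a
    by (rule phi_map_eqI[OF \<Phi>]) (use that in \<open>simp_all add: multiplicative_domain_def ip_act_right\<close>)
  have tern: "\<Phi> (x \<cdot> a \<cdot> b) = \<Phi> x \<circ>\<^sub>L \<phi> a \<circ>\<^sub>L \<phi> b" if a: "a \<in> ternary_domain_alg \<phi>" for x a b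
  proof -
    have "\<phi> (u * a * b) = \<phi> (u * a) \<circ>\<^sub>L \<phi> b" for u
      using a unfolding ternary_domain_alg_eq[OF cp] by (simp add: ternary_subalgebra_def)
    hence "\<Phi> (x \<cdot> a \<cdot> b) = \<Phi> (x \<cdot> a) \<circ>\<^sub>L \<phi> b"
      by (intro phi_map_eqI[OF \<Phi>]) (simp_all add: ip_act_right)
    thus ?thesis using mult a by (simp add: ternary_domain_alg_def)
  qed
  have "{x \<cdot> a | x a. a \<in> ternary_domain_alg \<phi>} = ternary_domain act \<phi> \<Phi>"
  proof (intro subset_antisym subsetI)
    fix z assume "z \<in> {x \<cdot> a | x a. a \<in> ternary_domain_alg \<phi>}"
    then obtain x a where z: "z = x \<cdot> a" and a: "a \<in> ternary_domain_alg \<phi>" by blast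
    thus "z \<in> ternary_domain act \<phi> \<Phi>"
      using tern[OF a] mult[of a] by (simp add: ternary_domain_def ternary_domain_alg_def)
  next
    fix x assume x: "x \<in> ternary_domain act \<phi> \<Phi>"
    obtain \<kappa> c f y a where f: "c = \<kappa> *\<^sub>R ip x x" "norm (1 - f) \<le> 1" "f ^ 32 = (Unitization 0 c)\<^sup>2"
      "\<And>B. closed_subalgebra B \<Longrightarrow> Unitization 0 c \<in> B \<Longrightarrow> f \<in> B"
      "Unitization 0 a = f ^ 4" "x = y \<cdot> a"
      by (rule factorization[OF assms(1), of x]) blast
    have "c \<in> ternary_subalgebra \<phi>"
      unfolding f(1) by (intro ternary_subalgebra_scaleR lin ternary_domain_ip[OF assms(1) cp \<Phi> x])
    hence "a \<in> ternary_domain_alg \<phi>"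
      unfolding ternary_domain_alg_eq[OF cp] by (rule ternary_subalgebra_root[OF cp lin _ f(2-5)])
    thus "x \<in> {x \<cdot> a | x a. a \<in> ternary_domain_alg \<phi>}" using f(6) by blast
  qed
  thus ?thesis using mult tern by blast
qed

end
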